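(* The numbers $\{|M_{n,k}|\}_{1\le k\le n}$ satisfy the local limit theorem with parameters $(\log n,\log n)$ and rate $(\log n)^{-1/2}$. That is, for $n\ge 2$ let $X_n$ be a random variable with $$\mathbb{P}(X_n=k)=\frac{|M_{n,k}|}{\sum_{1\le j\le n}|M_{n,j}|}\qquad(1\le k\le n)$$ and $\mathbb P(X_n=k)=0$ for all other integers $k$. Then, as $n\to\infty$, $\mathbb{E}(X_n)\sim\log n$, $\mathbb{V}(X_n)\sim\log n$, and $$\sup_{k\in\mathbb{Z}}\left|\sqrt{\log n}\;\mathbb{P}(X_n=k)-\frac{1}{\sqrt{2\pi}}\exp\left(-\frac{(k-\log n)^2}{2\log n}\right)\right|=O\left((\log n)^{-1/2}\right).$$
   Context: Let $s_{n,k}$ denote the signed Stirling numbers of the first kind, $\sum_{k} s_{n,k}z^k=z(z-1)\cdots(z-n+1)$. Let $\beta_n:=n![z^n]e^{e^z-1-z}$, the number of set partitions of $n$ labeled elements without singleton blocks (so $\beta_0=1,\beta_1=0,\beta_2=1,\beta_3=1,\beta_4=4$), where $[z^n]f(z)$ is the coefficient of $z^n$ in the Taylor expansion of $f$. The Matsunaga numbers $M_{n,k}$ are defined by the recurrence $M_{n,k}=nM_{n-1,k}+\beta_n s_{n,k}$ for $1\le k\le n$ (with $n\ge 2$), with boundary conditions $M_{n,k}=0$ for $n\le 1$, $k\le 0$ and $k>n$. $\mathbb{E}$ and $\mathbb{V}$ denote mean and variance. *)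

theory Defs
  imports
    "HOL-Probability.Probability"
    "HOL-Computational_Algebra.Computational_Algebra"
    "HOL-Library.Landau_Symbols"
begin

definition stirling1_signed :: "nat \<Rightarrow> nat \<Rightarrow> real" where
  "stirling1_signed n k = poly.coeff (\<Prod>i<n. [:0, 1:] - of_nat i) k"

definition singleton_free_bell :: "nat \<Rightarrow> real" where
  "singleton_free_bell n = fact n * fps_nth (fps_exp 1 oo (fps_exp 1 - 1 - fps_X)) n"

text \<open>The second index is an integer, since the local limit theorem takes a supremum over
  all integers.\<close>

fun matsunaga :: "nat \<Rightarrow> int \<Rightarrow> real" where
  "matsunaga 0 k = 0"
| "matsunaga (Suc n) k =
     (if Suc n \<ge> 2 \<and> 1 \<le> k \<and> k \<le> int (Suc n)
      then real (Suc n) * matsunaga n k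
             + singleton_free_bell (Suc n) * stirling1_signed (Suc n) (nat k)
      else 0)"

text \<open>The law of a random variable that takes each value \<open>k\<close> between \<open>1\<close> and \<open>n\<close> with probability
  proportional to \<open>\<bar>matsunaga n k\<bar>\<close>. For \<open>n \<ge> 2\<close> the weights do form a probability mass function, so that
  \<open>embed_pmf\<close> is meaningful: see \<open>pmf_matsunaga_pmf\<close> below.\<close>

definition matsunaga_pmf :: "nat \<Rightarrow> int pmf" where
  "matsunaga_pmf n = embed_pmf (\<lambda>k. if 1 \<le> k \<and> k \<le> int n
     then \<bar>matsunaga n k\<bar> / (\<Sum>j=1..int n. \<bar>matsunaga n j\<bar>) else 0)"

lemma stirling1_signed_same: "stirling1_signed n n = 1"
proof -
  let ?p = "\<Prod>i<n. [:0, 1:] - of_nat i :: real poly"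
  have eq: "[:0, 1:] - of_nat i = [:- of_nat i, 1 :: real:]" for i
    by (simp add: of_nat_poly)
  have "degree ?p = n"
    unfolding eq by (subst degree_prod_eq_sum_degree) auto
  moreover have "lead_coeff ?p = 1"
    unfolding eq by (simp add: lead_coeff_prod)
  ultimately show ?thesis
    by (simp add: stirling1_signed_def)
qed

lemma singleton_free_bell_pos:
  assumes "n \<ge> 2"
  shows "singleton_free_bell n > 0"
proof -
  define g :: "real fps" where "g = fps_exp 1 - 1 - fps_X"
  have g: "fps_nth g m = (if m \<ge> 2 then 1 / fact m else 0)" for m
    by (cases m; cases "m - 1") (auto simp: g_def fps_X_def algebra_simps)
  have pow: "fps_nth (g ^ i) m \<ge> 0" for i m
    by (induction i arbitrary: m) (auto simp: fps_mult_nth g intro!: sum_nonneg)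
  have "0 < fps_nth (fps_exp 1 :: real fps) 1 * fps_nth (g ^ 1) n"
    using assms by (simp add: g)
  also have "\<dots> \<le> (\<Sum>i=0..n. fps_nth (fps_exp 1) i * fps_nth (g ^ i) n)"
    by (rule member_le_sum) (use assms pow in auto)
  finally show ?thesis
    by (simp add: singleton_free_bell_def fps_compose_nth flip: g_def)
qed

lemma matsunaga_sum_pos:
  assumes "n \<ge> 2"
  shows "(\<Sum>j=1..int n. \<bar>matsunaga n j\<bar>) > 0"
proof -
  obtain m where m: "n = Suc m" using assms by (cases n) auto
  have z: "matsunaga m (int (Suc m)) = 0" by (cases m) auto
  have "matsunaga n (int n) = singleton_free_bell n"
    using assms z stirling1_signed_same[of n] by (simp add: m del: of_nat_Suc)
  hence "0 < \<bar>matsunaga n (int n)\<bar>"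
    using singleton_free_bell_pos[OF assms] by simp
  also have "\<dots> \<le> (\<Sum>j=1..int n. \<bar>matsunaga n j\<bar>)"
    by (rule member_le_sum) (use assms in auto)
  finally show ?thesis .
qed

lemma pmf_matsunaga_pmf:
  assumes "n \<ge> 2"
  shows "pmf (matsunaga_pmf n) k = (if 1 \<le> k \<and> k \<le> int n
     then \<bar>matsunaga n k\<bar> / (\<Sum>j=1..int n. \<bar>matsunaga n j\<bar>) else 0)"
  unfolding matsunaga_pmf_def
proof (rule pmf_embed_pmf)
  let ?S = "\<Sum>j=1..int n. \<bar>matsunaga n j\<bar>"
  let ?w = "\<lambda>k. if 1 \<le> k \<and> k \<le> int n then \<bar>matsunaga n k\<bar> / ?S else 0"
  have S: "?S > 0" by (rule matsunaga_sum_pos[OF assms])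
  show nn: "?w k \<ge> 0" for k using S by simp
  have "(\<integral>\<^sup>+ k. ennreal (?w k) \<partial>count_space UNIV) = (\<Sum>k=1..int n. ennreal (?w k))"
    by (rule nn_integral_count_space') auto
  also have "\<dots> = ennreal (\<Sum>k=1..int n. ?w k)"
    by (rule sum_ennreal) (rule nn)
  also have "(\<Sum>k=1..int n. ?w k) = (\<Sum>k=1..int n. \<bar>matsunaga n k\<bar> / ?S)"
    by (rule sum.cong) auto
  also have "\<dots> = 1"
    using S by (simp flip: sum_divide_distrib)
  finally show "(\<integral>\<^sup>+ k. ennreal (?w k) \<partial>count_space UNIV) = 1" by simp
qed

end

theory Submission
  imports Defs "HOL-Combinatorics.Stirling" "HOL-Real_Asymp.Real_Asymp"
begin

text \<open>
  Dividing by \<open>n!\<close>, the recurrence expresses \<open>M\<^sub>n\<^sub>,\<^sub>k\<close> as a sum of the terms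
  \<open>\<beta>\<^sub>j s\<^sub>j\<^sub>,\<^sub>k / j!\<close> over \<open>j \<le> n\<close>. Since \<open>\<beta>\<^sub>n \<le> 3 \<beta>\<^sub>n\<^sub>+\<^sub>1 / \<surd>n\<close>, the last term
  dominates, so that \<open>|M\<^sub>n\<^sub>,\<^sub>k| = \<beta>\<^sub>n |s\<^sub>n\<^sub>,\<^sub>k| (1 + O(n\<^sup>-\<^sup>1\<^sup>/\<^sup>2))\<close> uniformly in \<open>k\<close>. It remains
  to treat the law \<open>|s\<^sub>n\<^sub>,\<^sub>k| / n!\<close> of the number of cycles of a uniformly random permutation. Its
  characteristic function is \<open>\<Prod>\<^sub>m\<^sub>\<le>\<^sub>n (1 + (e\<^sup>i\<^sup>t - 1) / m)\<close>; a factorwise comparison with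
  \<open>exp ((i t - t\<^sup>2 / 2) / m)\<close> and Fourier inversion give the local limit theorem.
\<close>

subsection \<open>Set partitions without singletons\<close>

text \<open>The summands of \<open>M_{n,k}\<close> alternate in sign with \<open>j\<close>, but no
  cancellation is exploited: a bound on the ratio of successive \<beta> suffices. That ratio is
  really of order log n / n, yet any O(1 / log n) would do, because a relative error d changes sqrt
  (log n) P(X_n = k) by at most d sqrt (log n), which must be O((log n)^(-1/2)). This leaves room
  for a crude second-moment argument. All estimates for M are relative to the main term with the
  same k. Such bounds survive normalization and summation against nonnegative functions, so one
  pointwise comparison serves the local limit, the mean and the variance. On the Fourier side the
  comparison of products has to keep a decay exp(- t^2 log n / 16) on all of [-pi, pi]; without it
  the error would integrate to order log n instead of 1 / log n. The cycle count has mean H_n rather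
  than log n; this bounded shift costs a factor O(|t|), which at the scale t ~ (log n)^(-1/2) has
  the same order as the cubic Taylor error.\<close>

lemma singleton_free_bell_0: "singleton_free_bell 0 = 1"
  by (simp add: singleton_free_bell_def fps_compose_nth)

text \<open>Coefficients in F' = F (e^z - 1). The index \<open>n\<close> is missing because e^z - 1
  has no constant term: the block of the new element must contain another one.\<close>

lemma singleton_free_bell_Suc:
  "singleton_free_bell (Suc n) = (\<Sum>i<n. real (n choose i) * singleton_free_bell i)"
proof -
  define G :: "real fps" where "G = fps_exp 1 - 1 - fps_X"
  define F where "F = fps_exp 1 oo G"
  have "fps_deriv F = F * (fps_exp 1 - 1)"
    unfolding F_def by (subst fps_compose_deriv) (auto simp: G_def)
  hence "real (Suc n) * fps_nth F (Suc n) = fps_nth (F * (fps_exp 1 - 1)) n"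
    by (metis fps_deriv_nth Suc_eq_plus1)
  also have "\<dots> = (\<Sum>i=0..n. fps_nth F i * (if i = n then 0 else 1 / fact (n - i)))"
    unfolding fps_mult_nth by (intro sum.cong) auto
  also have "\<dots> = (\<Sum>i<n. fps_nth F i / fact (n - i))"
    by (intro sum.mono_neutral_cong_right) auto
  finally have "fact n * (real (Suc n) * fps_nth F (Suc n)) = fact n * (\<Sum>i<n. fps_nth F i / fact (n - i))"
    by (rule arg_cong)
  hence "fact (Suc n) * fps_nth F (Suc n) = fact n * (\<Sum>i<n. fps_nth F i / fact (n - i))"
    by (simp only: fact_Suc of_nat_mult mult_ac)
  also have "\<dots> = (\<Sum>i<n. real (n choose i) * (fact i * fps_nth F i))"
    unfolding sum_distrib_left by (intro sum.cong refl) (simp add: binomial_fact)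
  finally show ?thesis
    unfolding singleton_free_bell_def F_def G_def by simp
qed

lemma singleton_free_bell_nonneg: "singleton_free_bell n \<ge> 0"
proof (cases "n \<ge> 2")
  case False
  then consider "n = 0" | "n = 1" by linarith
  thus ?thesis
    by cases (simp_all add: singleton_free_bell_0 singleton_free_bell_Suc)
qed (use singleton_free_bell_pos[of n] in simp)

lemma singleton_free_bell_ge_1:
  assumes "n \<ge> 2"
  shows "singleton_free_bell n \<ge> 1"
proof -
  obtain m where m: "n = Suc m" "m \<ge> 1" using assms by (cases n) auto
  have "real (m choose 0) * singleton_free_bell 0 \<le> singleton_free_bell (Suc m)"
    unfolding singleton_free_bell_Suc
    by (rule member_le_sum) (use m singleton_free_bell_nonneg in auto)
  thus ?thesis using m by (simp add: singleton_free_bell_0)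
qed

text \<open>The contribution of the partitions in which a distinguished element lies in a block of
  size two.\<close>

lemma singleton_free_bell_Suc_Suc_ge:
  "singleton_free_bell (Suc (Suc n)) \<ge> real (Suc n) * singleton_free_bell n"
proof -
  have "real (Suc n choose n) * singleton_free_bell n \<le> singleton_free_bell (Suc (Suc n))"
    unfolding singleton_free_bell_Suc[of "Suc n"]
    by (rule member_le_sum) (use singleton_free_bell_nonneg in auto)
  thus ?thesis by simp
qed

lemma power_le_fact_exp:
  fixes x :: real
  assumes "x \<ge> 0"
  shows "x ^ n \<le> fact n * exp x"
proof -
  have "(\<Sum>k\<in>{n}. x ^ k /\<^sub>R fact k) \<le> (\<Sum>k. x ^ k /\<^sub>R fact k)"
    by (rule sum_le_suminf) (use assms summable_exp_generic[of x] in auto)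
  thus ?thesis by (simp add: exp_def field_simps)
qed

lemma summable_poisson_moment: "summable (\<lambda>k. (real k - 1) ^ n / fact k)"
proof (rule summable_comparison_test')
  \<comment> \<open>An extra factor \<open>exp k\<close> absorbs every fixed power of
    \<open>k\<close> and still leaves an exponential series, now at the point
    \<open>exp 1\<close>.\<close>
  show "summable (\<lambda>k. fact n * exp 1 * (exp 1 ^ k /\<^sub>R fact k) :: real)"
    by (intro summable_mult summable_exp_generic)
  fix k :: nat
  have "\<bar>real k - 1\<bar> ^ n \<le> (real k + 1) ^ n" by (rule power_mono) auto
  also have "\<dots> \<le> fact n * exp (real k + 1)" by (rule power_le_fact_exp) auto
  also have "exp (real k + 1) = exp 1 * exp 1 ^ k"
    by (simp add: exp_add exp_of_nat_mult[symmetric])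
  finally show "norm ((real k - 1) ^ n / fact k) \<le> fact n * exp 1 * (exp 1 ^ k /\<^sub>R fact k)"
    by (simp add: power_abs field_simps)
qed

text \<open>A formula of Dobinski type: \<open>\<beta>\<^sub>n\<close> is the \<open>n\<close>-th central moment of the Poisson law with mean 1.\<close>

lemma singleton_free_bell_sums:
  "(\<lambda>k. (real k - 1) ^ n / fact k) sums (exp 1 * singleton_free_bell n)"
proof (induction n rule: less_induct)
  case (less n)
  show ?case
  proof (cases n)
    case 0
    have "(\<lambda>k. 1 ^ k /\<^sub>R fact k) sums (exp 1 :: real)" by (rule exp_converges)
    thus ?thesis by (simp add: 0 singleton_free_bell_0 field_simps)
  next
    case (Suc m)
    define D where "D i = (\<Sum>k. (real k - 1) ^ i / fact k)" for i
    have D: "(\<lambda>k. (real k - 1) ^ i / fact k) sums D i" for i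
      unfolding D_def by (rule summable_sums[OF summable_poisson_moment])
    \<comment> \<open>The Poisson identity E X f(X) = E f(X + 1) for f(x) = (x - 1)^m, with X^m
      expanded in powers of X - 1.\<close>
    have "(\<lambda>k. \<Sum>i\<le>m. real (m choose i) * ((real k - 1) ^ i / fact k)) sums
            (\<Sum>i\<le>m. real (m choose i) * D i)"
      by (intro sums_sum sums_mult D)
    also have "(\<lambda>k. \<Sum>i\<le>m. real (m choose i) * ((real k - 1) ^ i / fact k)) =
               (\<lambda>k. real (Suc k) * (real (Suc k) - 1) ^ m / fact (Suc k))"
    proof
      fix k
      have "real k ^ m = ((real k - 1) + 1) ^ m" by simp
      also have "\<dots> = (\<Sum>i\<le>m. real (m choose i) * (real k - 1) ^ i)"
        by (subst binomial_ring) simp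
      finally show "(\<Sum>i\<le>m. real (m choose i) * ((real k - 1) ^ i / fact k)) =
               real (Suc k) * (real (Suc k) - 1) ^ m / fact (Suc k)"
        by (simp add: sum_divide_distrib)
    qed
    finally have "(\<lambda>k. real k * (real k - 1) ^ m / fact k) sums (\<Sum>i\<le>m. real (m choose i) * D i)"
      by (subst (asm) sums_Suc_iff) simp
    \<comment> \<open>Subtracting \<open>D m\<close> turns the factor \<open>k\<close> into
      \<open>k - 1\<close> and cancels the top term \<open>i = m\<close>, which leaves the
      recurrence for \<beta>.\<close>
    from sums_diff[OF this D[of m]]
    have "(\<lambda>k. (real k - 1) ^ Suc m / fact k) sums ((\<Sum>i\<le>m. real (m choose i) * D i) - D m)"
      by (simp add: field_simps)
    also have "(\<Sum>i\<le>m. real (m choose i) * D i) - D m = (\<Sum>i<m. real (m choose i) * D i)"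
      by (simp add: lessThan_Suc_atMost[symmetric])
    also have "\<dots> = (\<Sum>i<m. real (m choose i) * (exp 1 * singleton_free_bell i))"
      using sums_unique2[OF D less.IH] Suc by (intro sum.cong) auto
    also have "\<dots> = exp 1 * singleton_free_bell (Suc m)"
      by (simp add: singleton_free_bell_Suc sum_distrib_left algebra_simps)
    finally show ?thesis by (simp add: Suc)
  qed
qed

text \<open>The expectation of \<open>(X - 1)\<^sup>m (X - 1 - t)\<^sup>2\<close> for Poisson \<open>X\<close>, where only \<open>X = 0\<close> can contribute
  a negative amount. It is a substitute for log-convexity, which fails for small indices.\<close>

lemma singleton_free_bell_quadratic:
  assumes "t \<ge> 0"
  shows "singleton_free_bell (Suc (Suc m)) \<ge>
           2 * t * singleton_free_bell (Suc m) - t\<^sup>2 * singleton_free_bell m - (1 + t)\<^sup>2"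
proof -
  let ?b = singleton_free_bell
  have eq: "(real k - 1) ^ Suc (Suc m) / fact k - 2 * t * ((real k - 1) ^ Suc m / fact k)
     + t\<^sup>2 * ((real k - 1) ^ m / fact k) = (real k - 1) ^ m * (real k - 1 - t)\<^sup>2 / fact k" for k
    by (simp add: field_simps power2_eq_square)
  have "(\<lambda>k. (real k - 1) ^ m * (real k - 1 - t)\<^sup>2 / fact k) sums
     (exp 1 * ?b (Suc (Suc m)) - 2 * t * (exp 1 * ?b (Suc m)) + t\<^sup>2 * (exp 1 * ?b m))"
    unfolding eq[symmetric] by (intro sums_add sums_diff sums_mult singleton_free_bell_sums)
  moreover have "(\<lambda>k. if k = 0 then - ((1 + t)\<^sup>2) else 0) sums (- ((1 + t)\<^sup>2))"
    by (rule sums_single)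
  moreover have "(if k = 0 then - ((1 + t)\<^sup>2) else 0) \<le> (real k - 1) ^ m * (real k - 1 - t)\<^sup>2 / fact k" for k
    proof (cases k)
      case 0
      have "(-1) ^ m * (1 + t)\<^sup>2 \<ge> - ((1 + t)\<^sup>2)"
        by (cases "even m") auto
      moreover have "(- 1 - t)\<^sup>2 = (1 + t)\<^sup>2" by (simp add: power2_eq_square algebra_simps)
      ultimately show ?thesis using 0 by simp
    qed simp
  ultimately have "- ((1 + t)\<^sup>2) \<le>
     exp 1 * ?b (Suc (Suc m)) - 2 * t * (exp 1 * ?b (Suc m)) + t\<^sup>2 * (exp 1 * ?b m)"
    by (metis (mono_tags, lifting) sums_le)
  hence "- ((1 + t)\<^sup>2) \<le> exp 1 * (?b (Suc (Suc m)) - 2 * t * ?b (Suc m) + t\<^sup>2 * ?b m)"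
    by (simp add: algebra_simps)
  moreover have "exp 1 * x \<le> x" if "x < 0" for x :: real
    using mult_right_mono_neg[of 1 "exp 1" x] that by simp
  ultimately show ?thesis
    by (smt (verit, best) zero_le_power2)
qed

text \<open>Take \<open>t = sqrt n\<close> in the quadratic inequality. Then \<beta>_{n+1},
  \<open>t\<^sup>2\<close> \<beta>_{n-1} and \<open>(1 + t)\<^sup>2\<close> are at most 1, 1 and 4
  times \<beta>_{n+1}; the total 6 bounds \<open>2 * t\<close> \<beta>_n.\<close>

lemma singleton_free_bell_ratio:
  assumes "n \<ge> 3"
  shows "sqrt (real n) * singleton_free_bell n \<le> 3 * singleton_free_bell (Suc n)"
proof -
  obtain m where m: "n = Suc m" "m \<ge> 2" using assms by (cases n) auto
  let ?b = singleton_free_bell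
  define t where "t = sqrt (real n)"
  have t: "t \<ge> 1" "t\<^sup>2 = real n" using m by (simp_all add: t_def)
  have 1: "t\<^sup>2 * ?b m \<le> ?b (Suc n)"
    using singleton_free_bell_Suc_Suc_ge[of m] t m by simp
  have "t\<^sup>2 * 1 \<le> t\<^sup>2 * ?b m"
    using singleton_free_bell_ge_1[OF m(2)] by (intro mult_left_mono) auto
  hence 2: "t\<^sup>2 \<le> ?b (Suc n)" using 1 by simp
  have "(1 + t)\<^sup>2 \<le> (2 * t)\<^sup>2" using t by (intro power_mono) auto
  hence "(1 + t)\<^sup>2 \<le> 4 * ?b (Suc n)" using 2 by (simp add: power_mult_distrib)
  with singleton_free_bell_quadratic[of t m] 1 t have "t * ?b (Suc m) \<le> 3 * ?b (Suc n)"
    unfolding m(1) by (simp del: of_nat_Suc)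
  thus ?thesis by (simp add: m t_def)
qed

section \<open>Stirling numbers and the dominance of the last summand\<close>

lemma stirling1_signed_eq: "stirling1_signed n k = (-1) ^ (n + k) * real (stirling n k)"
proof (induction n arbitrary: k)
  case 0
  show ?case by (cases k) (simp_all add: stirling1_signed_def)
next
  case (Suc n)
  let ?p = "\<Prod>i<n. [:0, 1:] - of_nat i :: real poly"
  have "(\<Prod>i<Suc n. [:0, 1:] - of_nat i) = ?p * [:- real n, 1:]"
    by (simp add: of_nat_poly)
  hence "stirling1_signed (Suc n) k = coeff (?p * [:- real n, 1:]) k"
    by (simp add: stirling1_signed_def)
  also have "\<dots> = (if k = 0 then 0 else stirling1_signed n (k - 1)) - real n * stirling1_signed n k"
    by (cases k) (simp_all add: stirling1_signed_def)
  also have "\<dots> = (-1) ^ (Suc n + k) * real (stirling (Suc n) k)"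
    \<comment> \<open>For \<open>k = 0\<close> the product \<open>n * stirling n 0\<close> vanishes
      for two different reasons, according to whether \<open>n = 0\<close>.\<close>
    unfolding Suc.IH by (cases k; cases n) (auto simp: algebra_simps)
  finally show ?case .
qed

lemma stirling_Suc_ge:
  assumes "k \<ge> 1"
  shows "n * stirling n k \<le> stirling (Suc n) k"
  using assms by (cases k) auto

lemma stirling_pos:
  assumes "1 \<le> k" "k \<le> n"
  shows "stirling n k > 0"
  using assms
proof (induction n arbitrary: k)
  case (Suc n)
  then obtain j where k: "k = Suc j" by (cases k) auto
  show ?case
  proof (cases "k = Suc n")
    case False
    with Suc have "stirling n k > 0" "n > 0" by auto
    thus ?thesis by (simp add: k)
  qed simp
qed simp

lemma matsunaga_eq_0: "n < k \<Longrightarrow> matsunaga n (int k) = 0"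
  by (cases n) auto

text \<open>Beyond the boundary \<open>k = Suc n\<close> all terms vanish, so the case distinction
  of the definition disappears.\<close>

lemma matsunaga_Suc:
  assumes "n \<ge> 1" "k \<ge> 1"
  shows "matsunaga (Suc n) (int k) = real (Suc n) * matsunaga n (int k)
           + singleton_free_bell (Suc n) * stirling1_signed (Suc n) k"
  using assms by (cases "k \<le> Suc n") (auto simp: matsunaga_eq_0 stirling1_signed_eq)

definition matsunaga_main :: "nat \<Rightarrow> nat \<Rightarrow> real" where
  "matsunaga_main n k = singleton_free_bell n * real (stirling n k)"

lemma matsunaga_main_nonneg: "matsunaga_main n k \<ge> 0"
  by (simp add: matsunaga_main_def singleton_free_bell_nonneg)

lemma abs_singleton_free_bell_stirling: "\<bar>singleton_free_bell n * stirling1_signed n k\<bar> = matsunaga_main n k"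
  using singleton_free_bell_nonneg[of n]
  by (simp add: stirling1_signed_eq matsunaga_main_def abs_mult power_abs)

text \<open>The step loses 3 / sqrt n from \<beta>, while the Stirling numbers absorb the
  multiplier: \<open>Suc n \<le> 2 * n\<close>, and \<open>n * stirling n k\<close> is part of
  \<open>stirling (Suc n) k\<close>.\<close>

lemma matsunaga_main_Suc:
  assumes "n \<ge> 3" "k \<ge> 1"
  shows "real (Suc n) * matsunaga_main n k \<le> 6 / sqrt (real n) * matsunaga_main (Suc n) k"
proof -
  have b: "singleton_free_bell n \<le> 3 / sqrt (real n) * singleton_free_bell (Suc n)"
    using singleton_free_bell_ratio[OF assms(1)] assms(1) by (simp add: field_simps)
  have "real (n * stirling n k) \<le> real (stirling (Suc n) k)"
    using stirling_Suc_ge[OF assms(2), of n] by linarith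
  moreover have "real (Suc n) * real (stirling n k) \<le> (2 * real n) * real (stirling n k)"
    using assms by (intro mult_right_mono) auto
  ultimately have s: "real (Suc n) * real (stirling n k) \<le> 2 * real (stirling (Suc n) k)"
    by simp
  have "singleton_free_bell n * (real (Suc n) * real (stirling n k)) \<le>
        (3 / sqrt (real n) * singleton_free_bell (Suc n)) * (2 * real (stirling (Suc n) k))"
    using singleton_free_bell_nonneg by (intro mult_mono b s) auto
  thus ?thesis by (simp add: matsunaga_main_def field_simps)
qed

text \<open>From 144 = 12^2 on, \<open>6 / sqrt n \<le> 1 / 2\<close>, so the recurrence turns a
  bound C into C / 2 + 1 and a constant can be propagated.\<close>

lemma matsunaga_bound:
  "\<exists>C\<ge>0. \<forall>n\<ge>144. \<forall>k\<ge>1. \<bar>matsunaga n (int k)\<bar> \<le> C * matsunaga_main n k"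
proof -
  define N where "N = (144 :: nat)"
  \<comment> \<open>The summand 2 gives \<open>C / 2 + 1 \<le> C\<close>; the sum covers the base
    case, where every main term with \<open>1 \<le> k \<le> N\<close> is at least 1.\<close>
  define C where "C = (\<Sum>k=1..N. \<bar>matsunaga N (int k)\<bar>) + 2"
  have C: "C \<ge> 2" by (auto simp: C_def intro!: sum_nonneg)
  have "\<bar>matsunaga n (int k)\<bar> \<le> C * matsunaga_main n k" if "n \<ge> N" "k \<ge> 1" for n k
    using that
  proof (induction n rule: dec_induct)
    case base
    show ?case
    proof (cases "k \<le> N")
      case True
      have "\<bar>matsunaga N (int k)\<bar> \<le> (\<Sum>k=1..N. \<bar>matsunaga N (int k)\<bar>)"
        by (rule member_le_sum) (use True base in auto)
      also have "\<dots> \<le> C * (1 * 1)" by (simp add: C_def)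
      also have "\<dots> \<le> C * matsunaga_main N k"
        unfolding matsunaga_main_def
        using C stirling_pos[OF base True] singleton_free_bell_ge_1[of N]
        by (intro mult_left_mono mult_mono) (auto simp: N_def)
      finally show ?thesis .
    next
      case False
      thus ?thesis using C by (simp add: matsunaga_eq_0 matsunaga_main_nonneg)
    qed
  next
    case (step n)
    have n: "n \<ge> 144" using step by (simp add: N_def)
    have "6 / sqrt (real n) \<le> 1 / 2"
    proof -
      have "sqrt 144 \<le> sqrt (real n)" using n by (intro real_sqrt_le_mono) simp
      moreover have "sqrt 144 = (12 :: real)" by (rule real_sqrt_unique) auto
      ultimately show ?thesis using n by (simp add: divide_le_eq)
    qed
    hence "C * (6 / sqrt (real n) * matsunaga_main (Suc n) k) \<le>
             C * (1 / 2 * matsunaga_main (Suc n) k)"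
      using C by (intro mult_left_mono mult_right_mono matsunaga_main_nonneg) auto
    moreover have "C * (real (Suc n) * matsunaga_main n k) \<le>
                     C * (6 / sqrt (real n) * matsunaga_main (Suc n) k)"
      using C n step by (intro mult_left_mono matsunaga_main_Suc) auto
    ultimately have "C * (real (Suc n) * matsunaga_main n k) \<le> C * (1 / 2 * matsunaga_main (Suc n) k)"
      by linarith
    hence *: "real (Suc n) * (C * matsunaga_main n k) \<le> C / 2 * matsunaga_main (Suc n) k"
      by (simp only: mult_ac times_divide_eq_right mult_1_right)
    have "\<bar>matsunaga (Suc n) (int k)\<bar> \<le>
            \<bar>real (Suc n) * matsunaga n (int k)\<bar> + matsunaga_main (Suc n) k"
      unfolding abs_singleton_free_bell_stirling[symmetric]
      using n step.prems by (subst matsunaga_Suc) (auto intro: abs_triangle_ineq)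
    also have "\<bar>real (Suc n) * matsunaga n (int k)\<bar> = real (Suc n) * \<bar>matsunaga n (int k)\<bar>"
      by (simp add: abs_mult)
    also have "real (Suc n) * \<bar>matsunaga n (int k)\<bar> + matsunaga_main (Suc n) k
                 \<le> real (Suc n) * (C * matsunaga_main n k) + matsunaga_main (Suc n) k"
      using step by (intro add_mono mult_left_mono) auto
    also have "\<dots> \<le> (C / 2 + 1) * matsunaga_main (Suc n) k"
      using * by (simp add: algebra_simps)
    also have "\<dots> \<le> C * matsunaga_main (Suc n) k"
      using C by (intro mult_right_mono matsunaga_main_nonneg) auto
    finally show ?case .
  qed
  thus ?thesis using C unfolding N_def by (intro exI[of _ C]) auto
qed

text \<open>By the recurrence the signed error is exactly n M_{n-1,k}. The crude bound at
  \<open>n - 1\<close>, hence the threshold 145, shows that it is smaller than the main term by a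
  factor of order n^(-1/2).\<close>

lemma matsunaga_approx:
  "\<exists>C\<ge>0. \<forall>n\<ge>145. \<forall>k\<ge>1. \<bar>\<bar>matsunaga n (int k)\<bar> - matsunaga_main n k\<bar>
     \<le> C / sqrt (real n) * matsunaga_main n k"
proof -
  obtain C where C: "C \<ge> 0"
    "\<And>n k. n \<ge> 144 \<Longrightarrow> k \<ge> 1 \<Longrightarrow> \<bar>matsunaga n (int k)\<bar> \<le> C * matsunaga_main n k"
    using matsunaga_bound by blast
  have "\<bar>\<bar>matsunaga n (int k)\<bar> - matsunaga_main n k\<bar> \<le> 12 * C / sqrt (real n) * matsunaga_main n k"
    if n: "n \<ge> 145" and k: "k \<ge> 1" for n k
  proof -
    obtain m where m: "n = Suc m" "m \<ge> 144" using n by (cases n) auto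
    have "\<bar>\<bar>matsunaga n (int k)\<bar> - matsunaga_main n k\<bar> \<le> \<bar>real n * matsunaga m (int k)\<bar>"
      using matsunaga_Suc[of m k] abs_singleton_free_bell_stirling[of n k] m k
      by (simp add: m del: matsunaga.simps of_nat_Suc)
    also have "\<dots> \<le> real n * (C * matsunaga_main m k)"
      using C(2)[of m k] m k by (simp add: abs_mult mult_left_mono del: of_nat_Suc)
    also have "\<dots> = C * (real (Suc m) * matsunaga_main m k)" by (simp add: m)
    also have "\<dots> \<le> C * (6 / sqrt (real m) * matsunaga_main n k)"
      unfolding m(1) using m k C(1) by (intro mult_left_mono matsunaga_main_Suc) auto
    also have "\<dots> \<le> C * (12 / sqrt (real n) * matsunaga_main n k)"
    proof -
      have "sqrt (real n) \<le> sqrt (2\<^sup>2 * real m)" using m by (intro real_sqrt_le_mono) auto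
      hence "sqrt (real n) \<le> 2 * sqrt (real m)" by (simp add: real_sqrt_mult)
      hence "6 / sqrt (real m) \<le> 12 / sqrt (real n)" using m by (simp add: field_simps)
      thus ?thesis by (intro mult_left_mono mult_right_mono matsunaga_main_nonneg C(1))
    qed
    finally show ?thesis by (simp add: mult_ac)
  qed
  thus ?thesis using C(1) by (intro exI[of _ "12 * C"]) auto
qed

subsection \<open>Cycles of random permutations\<close>

definition cycle_prob :: "nat \<Rightarrow> nat \<Rightarrow> real" where
  "cycle_prob n k = real (stirling n k) / fact n"

lemma cycle_prob_nonneg: "cycle_prob n k \<ge> 0"
  by (simp add: cycle_prob_def)

lemma cycle_prob_0: "n \<ge> 1 \<Longrightarrow> cycle_prob n 0 = 0"
  by (simp add: cycle_prob_def)

lemma cycle_prob_gt: "n < k \<Longrightarrow> cycle_prob n k = 0"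
  by (simp add: cycle_prob_def)

lemma sum_cycle_prob: "(\<Sum>k\<le>n. cycle_prob n k) = 1"
proof -
  have "(\<Sum>k\<le>n. cycle_prob n k) = real (\<Sum>k\<le>n. stirling n k) / fact n"
    by (simp add: cycle_prob_def sum_divide_distrib)
  thus ?thesis by (simp add: sum_stirling del: of_nat_sum)
qed

text \<open>The element \<open>Suc n\<close> opens a new cycle with probability
  \<open>1 / Suc n\<close>; otherwise it is inserted into an old one.\<close>

lemma sum_cycle_prob_Suc:
  fixes f :: "nat \<Rightarrow> real"
  shows "(\<Sum>k\<le>Suc n. f k * cycle_prob (Suc n) k) =
           (\<Sum>k\<le>n. ((real n * f k + f (Suc k)) / real (Suc n)) * cycle_prob n k)"
proof -
  have [simp]: "cycle_prob (Suc n) 0 = 0"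
    by (simp add: cycle_prob_def)
  have step: "real (Suc n) * cycle_prob (Suc n) (Suc k) = real n * cycle_prob n (Suc k) + cycle_prob n k" for k
    by (simp add: cycle_prob_def ring_distribs add_divide_distrib del: of_nat_Suc)
  \<comment> \<open>The shift adds index \<open>Suc n\<close>, which has probability 0, and drops
    index 0, where either the factor \<open>n\<close> or the probability is 0.\<close>
  have shift: "(\<Sum>k\<le>n. real n * (f (Suc k) * cycle_prob n (Suc k))) = (\<Sum>k\<le>n. real n * (f k * cycle_prob n k))"
  proof (cases "n = 0")
    case False
    have "(\<Sum>k\<le>n. real n * (f k * cycle_prob n k)) = (\<Sum>k\<le>Suc n. real n * (f k * cycle_prob n k))"
      by (simp add: cycle_prob_gt)
    also have "\<dots> = (\<Sum>k\<le>n. real n * (f (Suc k) * cycle_prob n (Suc k)))"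
      using False by (subst sum.atMost_Suc_shift) (simp add: cycle_prob_0)
    finally show ?thesis by simp
  qed simp
  have "real (Suc n) * (\<Sum>k\<le>Suc n. f k * cycle_prob (Suc n) k) =
        (\<Sum>k\<le>n. f (Suc k) * (real (Suc n) * cycle_prob (Suc n) (Suc k)))"
    by (subst sum.atMost_Suc_shift) (simp add: sum_distrib_left mult_ac)
  also have "\<dots> = (\<Sum>k\<le>n. real n * (f (Suc k) * cycle_prob n (Suc k))) + (\<Sum>k\<le>n. f (Suc k) * cycle_prob n k)"
    unfolding step by (simp add: algebra_simps sum.distrib)
  also have "\<dots> = (\<Sum>k\<le>n. (real n * f k + f (Suc k)) * cycle_prob n k)"
    unfolding shift by (simp add: algebra_simps sum.distrib)
  finally show ?thesis
    by (simp add: field_simps flip: sum_divide_distrib)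
qed

section \<open>Mean and variance of the number of cycles\<close>

definition cycle_mean :: "nat \<Rightarrow> real" where
  "cycle_mean n = (\<Sum>k\<le>n. real k * cycle_prob n k)"

definition cycle_var :: "nat \<Rightarrow> real" where
  "cycle_var n = (\<Sum>k\<le>n. (real k - cycle_mean n)\<^sup>2 * cycle_prob n k)"

lemma cycle_mean_eq: "cycle_mean n = harm n"
proof (induction n)
  case (Suc n)
  have "cycle_mean (Suc n) = (\<Sum>k\<le>n. (real k + 1 / real (Suc n)) * cycle_prob n k)"
    unfolding cycle_mean_def sum_cycle_prob_Suc
    by (intro sum.cong refl arg_cong2[of _ _ _ _ "(*)"]) (simp add: field_simps)
  also have "\<dots> = cycle_mean n + 1 / real (Suc n)"
    by (simp add: cycle_mean_def ring_distribs sum.distrib sum_cycle_prob flip: sum_distrib_left sum_divide_distrib)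
  finally show ?case by (simp add: Suc harm_Suc field_simps)
qed (simp add: cycle_mean_def harm_def)

text \<open>An arbitrary centre is allowed because it is applied at the mean for \<open>n\<close>
  under the law for \<open>Suc n\<close>, and later at the mean of the Matsunaga law.\<close>

lemma cycle_second_moment:
  "(\<Sum>k\<le>n. (real k - c)\<^sup>2 * cycle_prob n k) = cycle_var n + (cycle_mean n - c)\<^sup>2"
proof -
  let ?m = "cycle_mean n"
  have "(\<Sum>k\<le>n. (real k - c)\<^sup>2 * cycle_prob n k) =
        (\<Sum>k\<le>n. (real k - ?m)\<^sup>2 * cycle_prob n k + 2 * (?m - c) * (real k * cycle_prob n k)
                 - (?m\<^sup>2 - c\<^sup>2) * cycle_prob n k)"
    by (intro sum.cong) (auto simp: power2_eq_square algebra_simps)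
  also have "\<dots> = cycle_var n + 2 * (?m - c) * ?m - (?m\<^sup>2 - c\<^sup>2)"
    by (simp add: sum.distrib sum_subtractf cycle_var_def sum_cycle_prob flip: sum_distrib_left)
       (simp add: cycle_mean_def)
  finally show ?thesis by (simp add: power2_eq_square algebra_simps)
qed

text \<open>The increment is the variance of a Bernoulli variable with parameter
  \<open>1 / Suc n\<close>. Centring at the old mean makes the recursion direct; the shift of the
  mean then accounts for the negative square.\<close>

lemma cycle_var_Suc: "cycle_var (Suc n) = cycle_var n + 1 / real (Suc n) - 1 / real (Suc n) ^ 2"
proof -
  let ?m = "cycle_mean n"
  have m: "cycle_mean (Suc n) = ?m + 1 / real (Suc n)"
    by (simp add: cycle_mean_eq harm_Suc field_simps)
  have "(\<Sum>k\<le>Suc n. (real k - ?m)\<^sup>2 * cycle_prob (Suc n) k) =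
     (\<Sum>k\<le>n. (real k - ?m)\<^sup>2 * cycle_prob n k + (2 * (real k * cycle_prob n k) - (2 * ?m - 1) * cycle_prob n k) / real (Suc n))"
    unfolding sum_cycle_prob_Suc
    by (intro sum.cong refl) (simp add: field_simps power2_eq_square)
  also have "\<dots> = cycle_var n + (2 * ?m - (2 * ?m - 1)) / real (Suc n)"
    by (simp add: sum.distrib sum_subtractf cycle_var_def sum_cycle_prob flip: sum_distrib_left sum_divide_distrib)
       (simp add: cycle_mean_def)
  finally have "cycle_var (Suc n) + (cycle_mean (Suc n) - ?m)\<^sup>2 = cycle_var n + 1 / real (Suc n)"
    unfolding cycle_second_moment by simp
  thus ?thesis by (simp add: m power_divide)
qed

lemma cycle_var_eq: "cycle_var n = harm n - (\<Sum>i<n. 1 / real (Suc i) ^ 2)"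
proof (induction n)
  case 0
  show ?case by (simp add: cycle_var_def cycle_prob_def cycle_mean_eq harm_def)
next
  case (Suc n)
  show ?case by (simp add: cycle_var_Suc Suc harm_Suc field_simps)
qed

lemma sum_inverse_squares_le: "(\<Sum>i<n. 1 / real (Suc i) ^ 2) \<le> 2"
proof -
  \<comment> \<open>Strengthened by \<open>- 1 / n\<close> so that the induction telescopes.\<close>
  have "(\<Sum>i<n. 1 / real (Suc i) ^ 2) \<le> 2 - 1 / real n" if "n \<ge> 1"
    using that
  proof (induction n rule: dec_induct)
    case (step n)
    have "1 / real (Suc n) ^ 2 \<le> 1 / real n - 1 / real (Suc n)"
      using step by (simp add: divide_simps power2_eq_square)
    thus ?case using step by simp
  qed simp
  thus ?thesis by (cases "n = 0") (auto intro: order.trans)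
qed

lemma harm_le_ln:
  assumes "n \<ge> 1"
  shows "harm n \<le> ln (real n) + 1"
  using assms
proof (induction n rule: dec_induct)
  case (step n)
  have "ln (real n / real (Suc n)) \<le> real n / real (Suc n) - 1"
    using step by (intro ln_le_minus_one) auto
  also have "real n / real (Suc n) - 1 = - (1 / real (Suc n))"
    by (simp add: field_simps)
  also have "ln (real n / real (Suc n)) = ln (real n) - ln (real (Suc n))"
    using step by (intro ln_divide_pos) auto
  finally show ?case using step by (simp add: harm_Suc inverse_eq_divide)
qed (simp add: harm_def)

lemma harm_ge_ln':
  assumes "n \<ge> 1"
  shows "harm n \<ge> ln (real n)"
proof -
  have "ln (real n) \<le> ln (real n + 1)" using assms by simp
  thus ?thesis using ln_le_harm[of n] by linarith
qed

subsection \<open>The characteristic function of the number of cycles\<close>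

definition cycle_char :: "nat \<Rightarrow> real \<Rightarrow> complex" where
  "cycle_char n t = (\<Sum>k\<le>n. of_real (cycle_prob n k) * iexp (t * real k))"

text \<open>The Stirling numbers are the coefficients of the rising factorial, evaluated here at
  \<open>iexp t\<close>. Each factor is the characteristic function of a Bernoulli variable with
  parameter \<open>1 / Suc i\<close>.\<close>

lemma cycle_char_eq_prod:
  "cycle_char n t = (\<Prod>i<n. 1 + (iexp t - 1) / of_nat (Suc i))"
proof -
  have "cycle_char n t = pochhammer (iexp t) n / fact n"
    unfolding stirling_pochhammer[symmetric] cycle_char_def sum_divide_distrib
    by (intro sum.cong refl)
       (simp add: cycle_prob_def exp_of_nat_mult[symmetric] mult_ac)
  also have "pochhammer (iexp t) n / fact n = (\<Prod>i<n. (iexp t + of_nat i) / of_nat (Suc i))"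
  proof (induction n)
    case (Suc n)
    show ?case
      by (simp add: pochhammer_Suc Suc.IH[symmetric] del: of_nat_Suc)
  qed simp
  also have "\<dots> = (\<Prod>i<n. 1 + (iexp t - 1) / of_nat (Suc i))"
    by (intro prod.cong refl) (simp add: field_simps del: of_nat_Suc, simp)
  finally show ?thesis .
qed

text \<open>The division by \<open>g i\<close> accounts for the one factor missing from each term of the telescoping sum.\<close>

lemma norm_prod_diff_weighted:
  fixes a b :: "nat \<Rightarrow> 'a :: {real_normed_field}"
  assumes "\<And>i. i < n \<Longrightarrow> norm (a i) \<le> g i" "\<And>i. i < n \<Longrightarrow> norm (b i) \<le> g i" "\<And>i. i < n \<Longrightarrow> g i > 0"
  shows "norm ((\<Prod>i<n. a i) - (\<Prod>i<n. b i)) \<le> (\<Prod>i<n. g i) * (\<Sum>i<n. norm (a i - b i) / g i)"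
  using assms
proof (induction n)
  case (Suc n)
  define A where "A = (\<Prod>i<n. a i)"
  define B where "B = (\<Prod>i<n. b i)"
  define G where "G = (\<Prod>i<n. g i)"
  define S where "S = (\<Sum>i<n. norm (a i - b i) / g i)"
  have IH: "norm (A - B) \<le> G * S"
    using Suc unfolding A_def B_def G_def S_def by simp
  have B: "norm B \<le> G"
    unfolding B_def G_def prod_norm[symmetric] by (rule prod_mono) (use Suc.prems in auto)
  have "A * a n - B * b n = a n * (A - B) + (a n - b n) * B"
    by (simp add: algebra_simps)
  hence "norm (A * a n - B * b n) \<le> norm (a n) * norm (A - B) + norm (a n - b n) * norm B"
    by (metis norm_mult norm_triangle_ineq)
  also have "\<dots> \<le> g n * (G * S) + norm (a n - b n) * G"
    using Suc.prems by (intro add_mono mult_mono IH B) (auto intro: less_imp_le)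
  also have "\<dots> = (G * g n) * (S + norm (a n - b n) / g n)"
    using Suc.prems(3)[of n] by (simp add: field_simps)
  finally show ?case by (simp add: A_def B_def G_def S_def)
qed simp

text \<open>The Taylor bound loses t^4 / 24, and \<open>t\<^sup>2 \<le> 10.5\<close> on the
  interval; 1/2 - 10.5/24 = 1/16.\<close>

lemma cos_le_quadratic:
  fixes t :: real
  assumes "\<bar>t\<bar> \<le> pi"
  shows "1 - cos t \<ge> t\<^sup>2 / 16"
proof -
  have "cmod (iexp t - (\<Sum>k\<le>3. (\<i> * t) ^ k / fact k)) \<le> \<bar>t\<bar> ^ 4 / fact 4"
    using iexp_approx1[of t 3] by (simp add: eval_nat_numeral)
  hence "\<bar>Re (iexp t - (\<Sum>k\<le>3. (\<i> * t) ^ k / fact k))\<bar> \<le> \<bar>t\<bar> ^ 4 / fact 4"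
    using abs_Re_le_cmod order.trans by blast
  also have "Re (iexp t - (\<Sum>k\<le>3. (\<i> * t) ^ k / fact k)) = cos t - 1 + t\<^sup>2 / 2"
    by (simp add: eval_nat_numeral Re_exp)
  also have "\<bar>t\<bar> ^ 4 / fact 4 = t\<^sup>2 * t\<^sup>2 / 24"
    by (simp add: eval_nat_numeral)
  finally have "cos t - 1 + t\<^sup>2 / 2 \<le> t\<^sup>2 * t\<^sup>2 / 24"
    by linarith
  moreover have "t\<^sup>2 * t\<^sup>2 \<le> t\<^sup>2 * 10.5"
  proof (rule mult_left_mono)
    have "\<bar>t\<bar>\<^sup>2 \<le> pi\<^sup>2" using assms by (intro power_mono) auto
    also have "\<dots> \<le> 3.2\<^sup>2" using pi_approx by (intro power_mono) auto
    finally show "t\<^sup>2 \<le> 10.5" by (simp add: power2_eq_square)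
  qed auto
  ultimately show ?thesis by simp
qed

lemma sq_le_of_le_pi:
  fixes t :: real
  assumes "\<bar>t\<bar> \<le> pi"
  shows "t\<^sup>2 \<le> 12"
proof -
  have "\<bar>t\<bar>\<^sup>2 \<le> pi\<^sup>2" using assms by (intro power_mono) auto
  also have "\<dots> \<le> 3.2\<^sup>2" using pi_approx by (intro power_mono) auto
  finally show ?thesis by (simp add: power2_eq_square)
qed

lemma norm_gaussian_exponent_le:
  fixes t :: real
  assumes "\<bar>t\<bar> \<le> pi"
  shows "norm (\<i> * of_real t - of_real (t\<^sup>2 / 2)) \<le> 2 * \<bar>t\<bar>"
proof (rule power2_le_imp_le)
  define w where "w = \<i> * of_real t - of_real (t\<^sup>2 / 2)"
  have "Re w = - (t\<^sup>2 / 2)" "Im w = t" by (simp_all add: w_def)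
  hence "(norm w)\<^sup>2 = t\<^sup>2 + t\<^sup>2 * (t\<^sup>2 / 4)"
    unfolding cmod_power2 by (simp add: power2_eq_square)
  also have "\<dots> \<le> t\<^sup>2 + t\<^sup>2 * 3"
    using sq_le_of_le_pi[OF assms] by (intro add_left_mono mult_left_mono) auto
  finally show "(norm (\<i> * of_real t - of_real (t\<^sup>2 / 2)))\<^sup>2 \<le> (2 * \<bar>t\<bar>)\<^sup>2"
    by (simp add: power_mult_distrib w_def)
qed auto

text \<open>The squared norm is 1 - 2 (x - x^2) (1 - cos t), where x - x^2 is the Bernoulli
  variance; then 1 - y \<le> exp (- y).\<close>

lemma norm_cycle_factor_le:
  fixes t x :: real
  assumes "\<bar>t\<bar> \<le> pi" "0 \<le> x" "x \<le> 1"
  shows "norm (1 + (iexp t - 1) * of_real x) \<le> exp (- (t\<^sup>2 / 16) * (x - x\<^sup>2))"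
proof -
  have sc: "(sin t)\<^sup>2 = 1 - (cos t)\<^sup>2"
    by (simp add: sin_squared_eq)
  have "(norm (1 + (iexp t - 1) * of_real x))\<^sup>2 = (1 + (cos t - 1) * x)\<^sup>2 + (sin t * x)\<^sup>2"
    by (simp add: cmod_power2 Re_exp Im_exp)
  also have "\<dots> = 1 - 2 * (x - x\<^sup>2) * (1 - cos t)"
    by (simp add: power_mult_distrib sc) (simp add: power2_eq_square algebra_simps)
  also have "\<dots> \<le> 1 - 2 * (x - x\<^sup>2) * (t\<^sup>2 / 16)"
    using assms cos_le_quadratic[of t]
    by (intro diff_left_mono mult_left_mono) (auto simp: power2_eq_square mult_left_le)
  also have "\<dots> \<le> exp (- (2 * (x - x\<^sup>2) * (t\<^sup>2 / 16)))"
    using exp_ge_add_one_self[of "- (2 * (x - x\<^sup>2) * (t\<^sup>2 / 16))"] by simp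
  also have "\<dots> = (exp (- (t\<^sup>2 / 16) * (x - x\<^sup>2)))\<^sup>2"
    by (simp add: power2_eq_square flip: exp_add)
  finally show ?thesis by (rule power2_le_imp_le) auto
qed

text \<open>Two errors: replacing \<open>iexp t - 1\<close> by \<open>w\<close> is cubic in t and
  linear in x, replacing \<open>1 + w * x\<close> by its exponential is quadratic in both. Only the
  first is summed against the harmonic series. The constant \<open>exp 6\<close> comes from |Re (w
  x)| = t^2 x / 2 \<le> 6.\<close>

lemma cycle_factor_diff:
  fixes t x :: real
  assumes "\<bar>t\<bar> \<le> pi" "0 \<le> x" "x \<le> 1"
  defines "w \<equiv> \<i> * of_real t - of_real (t\<^sup>2 / 2)"
  shows "norm (1 + (iexp t - 1) * of_real x - exp (w * of_real x))
           \<le> \<bar>t\<bar> ^ 3 * x + 4 * exp 6 * t\<^sup>2 * x\<^sup>2"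
proof -
  have t: "t\<^sup>2 \<le> 12" using assms(1) by (rule sq_le_of_le_pi)
  have "cmod (iexp t - (\<Sum>k\<le>2. (\<i> * t) ^ k / fact k)) \<le> \<bar>t\<bar> ^ 3 / fact 3"
    using iexp_approx1[of t 2] by (simp add: eval_nat_numeral)
  also have "\<bar>t\<bar> ^ 3 / fact 3 \<le> \<bar>t\<bar> ^ 3"
    by (simp add: divide_le_eq fact_numeral mult_left_le)
  also have "(\<Sum>k\<le>2. (\<i> * t) ^ k / fact k) = 1 + w"
    by (simp add: eval_nat_numeral w_def field_simps)
  finally have 1: "norm (iexp t - 1 - w) \<le> \<bar>t\<bar> ^ 3"
    by (simp add: diff_diff_eq)
  have "(norm w)\<^sup>2 \<le> (2 * \<bar>t\<bar>)\<^sup>2"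
    unfolding w_def by (intro power_mono norm_gaussian_exponent_le assms) auto
  hence w2: "(norm w)\<^sup>2 \<le> 4 * t\<^sup>2" by (simp add: power_mult_distrib)
  have "norm (exp (w * of_real x) - (1 + w * of_real x)) \<le>
          exp \<bar>Re (w * of_real x)\<bar> * norm (w * of_real x) ^ 2"
    using Taylor_exp[of "w * of_real x" 1] by (simp add: eval_nat_numeral)
  also have "norm (w * of_real x) ^ 2 = (norm w)\<^sup>2 * x\<^sup>2"
    by (simp add: norm_mult power_mult_distrib)
  also have "exp \<bar>Re (w * of_real x)\<bar> * ((norm w)\<^sup>2 * x\<^sup>2) \<le> exp 6 * (4 * t\<^sup>2 * x\<^sup>2)"
  proof (intro mult_mono w2)
    have "t\<^sup>2 * x \<le> 12 * 1" using t assms by (intro mult_mono) auto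
    thus "exp \<bar>Re (w * of_real x)\<bar> \<le> exp 6"
      using assms by (simp add: w_def abs_mult)
  qed auto
  finally have 2: "norm (exp (w * of_real x) - (1 + w * of_real x)) \<le> 4 * exp 6 * t\<^sup>2 * x\<^sup>2"
    by (simp add: mult_ac)
  have "norm ((iexp t - 1 - w) * of_real x) \<le> \<bar>t\<bar> ^ 3 * x"
    using 1 assms by (simp add: norm_mult mult_right_mono)
  moreover have "1 + (iexp t - 1) * of_real x - exp (w * of_real x) =
     (iexp t - 1 - w) * of_real x - (exp (w * of_real x) - (1 + w * of_real x))"
    by (simp add: algebra_simps)
  ultimately show ?thesis using 2
    by (smt (verit, best) norm_triangle_ineq4)
qed

text \<open>Both products are dominated by that of the bounds \<open>g\<close>, whose exponents sum
  to t^2 / 16 times the variance; this keeps the decay in \<open>ln n\<close>. The 8 is 4 times the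
  bound 2 for the sum of squares.\<close>

lemma cycle_char_approx_harm:
  fixes t :: real
  assumes t: "\<bar>t\<bar> \<le> pi" and n: "n \<ge> 1"
  defines "w \<equiv> \<i> * of_real t - of_real (t\<^sup>2 / 2)"
  shows "norm (cycle_char n t - exp (w * of_real (harm n)))
           \<le> exp 3 * exp (- (t\<^sup>2 / 16) * ln (real n)) * (\<bar>t\<bar> ^ 3 * (ln (real n) + 1) + 8 * exp 6 * t\<^sup>2)"
proof -
  define x where "x i = 1 / real (Suc i)" for i
  define g where "g i = exp (- (t\<^sup>2 / 16) * (x i - (x i)\<^sup>2))" for i
  define a where "a i = 1 + (iexp t - 1) * of_real (x i)" for i
  define b where "b i = exp (w * of_real (x i))" for i
  have x: "0 \<le> x i" "x i \<le> 1" for i by (auto simp: x_def)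
  have t2: "t\<^sup>2 \<le> 12" using t by (rule sq_le_of_le_pi)
  have sum_x: "(\<Sum>i<n. x i) = harm n"
    by (simp add: x_def harm_altdef inverse_eq_divide)
  have sum_x2: "(\<Sum>i<n. (x i)\<^sup>2) \<le> 2"
    using sum_inverse_squares_le[of n] by (simp add: x_def power_divide)
  have "norm ((\<Prod>i<n. a i) - (\<Prod>i<n. b i)) \<le> (\<Prod>i<n. g i) * (\<Sum>i<n. norm (a i - b i) / g i)"
  proof (rule norm_prod_diff_weighted)
    fix i
    show "norm (a i) \<le> g i" unfolding a_def g_def by (rule norm_cycle_factor_le) (use t x in auto)
    \<comment> \<open>The factor 8 is the quotient of 1/2, the exponent of the Gaussian factor, and
      1/16.\<close>
    have "x i - (x i)\<^sup>2 \<le> x i * 8"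
      using x[of i] zero_le_power2[of "x i"] by linarith
    hence "t\<^sup>2 * (x i - (x i)\<^sup>2) \<le> t\<^sup>2 * x i * 8"
      unfolding mult.assoc by (rule mult_left_mono) auto
    thus "norm (b i) \<le> g i"
      by (simp add: b_def g_def w_def norm_exp_eq_Re)
    show "g i > 0" by (simp add: g_def)
  qed
  also have "(\<Prod>i<n. a i) = cycle_char n t"
    by (simp add: cycle_char_eq_prod a_def x_def del: of_nat_Suc)
  also have "(\<Prod>i<n. b i) = exp (w * of_real (harm n))"
    by (simp add: b_def flip: sum_x exp_sum sum_distrib_left)
  also have "(\<Prod>i<n. g i) * (\<Sum>i<n. norm (a i - b i) / g i) \<le>
     (exp 2 * exp (- (t\<^sup>2 / 16) * ln (real n))) * (exp 1 * (\<bar>t\<bar> ^ 3 * (ln (real n) + 1) + 8 * exp 6 * t\<^sup>2))"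
  proof (rule mult_mono)
    have "(\<Prod>i<n. g i) = exp (- (t\<^sup>2 / 16) * (harm n - (\<Sum>i<n. (x i)\<^sup>2)))"
      unfolding g_def sum_x[symmetric] sum_subtractf[symmetric] sum_distrib_left
      by (simp add: exp_sum)
    also have "\<dots> \<le> exp (2 + - (t\<^sup>2 / 16) * ln (real n))"
    proof -
      have "t\<^sup>2 / 16 * (ln (real n) - 2) \<le> t\<^sup>2 / 16 * (harm n - (\<Sum>i<n. (x i)\<^sup>2))"
        using harm_ge_ln'[OF n] sum_x2 by (intro mult_left_mono) auto
      moreover have "t\<^sup>2 / 16 * (ln (real n) - 2) \<ge> t\<^sup>2 / 16 * ln (real n) - 2"
        using t2 by (simp add: algebra_simps)
      ultimately show ?thesis by simp
    qed
    finally show "(\<Prod>i<n. g i) \<le> exp 2 * exp (- (t\<^sup>2 / 16) * ln (real n))"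
      by (simp only: exp_add)
  next
    have "norm (a i - b i) / g i \<le> exp 1 * (\<bar>t\<bar> ^ 3 * x i + 4 * exp 6 * t\<^sup>2 * (x i)\<^sup>2)" for i
    proof -
      have "1 / g i = exp (t\<^sup>2 / 16 * (x i - (x i)\<^sup>2))"
        by (simp add: g_def exp_minus field_simps)
      also have "\<dots> \<le> exp 1"
      proof -
        have "t\<^sup>2 / 16 * (x i - (x i)\<^sup>2) \<le> 1 * 1"
          using t2 x[of i] by (intro mult_mono) (auto simp: power2_eq_square mult_left_le intro: order.trans[of _ "x i"])
        thus ?thesis by simp
      qed
      finally have 1: "1 / g i \<le> exp 1" .
      have 2: "norm (a i - b i) \<le> \<bar>t\<bar> ^ 3 * x i + 4 * exp 6 * t\<^sup>2 * (x i)\<^sup>2"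
        unfolding a_def b_def w_def by (rule cycle_factor_diff) (use t x in auto)
      have "1 / g i * norm (a i - b i) \<le> exp 1 * (\<bar>t\<bar> ^ 3 * x i + 4 * exp 6 * t\<^sup>2 * (x i)\<^sup>2)"
        by (intro mult_mono 1 2) auto
      thus ?thesis by simp
    qed
    hence "(\<Sum>i<n. norm (a i - b i) / g i) \<le>
             (\<Sum>i<n. exp 1 * (\<bar>t\<bar> ^ 3 * x i + 4 * exp 6 * t\<^sup>2 * (x i)\<^sup>2))"
      by (intro sum_mono)
    also have "\<dots> = exp 1 * (\<bar>t\<bar> ^ 3 * harm n + 4 * exp 6 * t\<^sup>2 * (\<Sum>i<n. (x i)\<^sup>2))"
      by (simp only: sum.distrib sum_distrib_left ring_distribs flip: sum_x)
    also have "\<dots> \<le> exp 1 * (\<bar>t\<bar> ^ 3 * (ln (real n) + 1) + 4 * exp 6 * t\<^sup>2 * 2)"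
      using harm_le_ln[OF n] sum_x2 by (intro mult_left_mono add_mono) auto
    finally show "(\<Sum>i<n. norm (a i - b i) / g i) \<le>
       exp 1 * (\<bar>t\<bar> ^ 3 * (ln (real n) + 1) + 8 * exp 6 * t\<^sup>2)" by (simp add: mult.assoc)
  qed (auto intro!: sum_nonneg prod_nonneg simp: g_def)
  also have "\<dots> = exp 3 * exp (- (t\<^sup>2 / 16) * ln (real n)) *
                   (\<bar>t\<bar> ^ 3 * (ln (real n) + 1) + 8 * exp 6 * t\<^sup>2)"
    using exp_add[of 2 "1::real"] by (simp add: mult_ac)
  finally show ?thesis .
qed

text \<open>Since \<open>harm n - ln n\<close> lies in [0, 1], changing the exponent costs O(|t|).
  Under t = u / sqrt L both |t| and L |t|^3 scale like L^(-1/2), so the remaining lower powers can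
  be absorbed into |t|.\<close>

lemma cycle_char_approx:
  "\<exists>K\<ge>0. \<forall>n\<ge>1. \<forall>t. \<bar>t\<bar> \<le> pi \<longrightarrow>
     norm (cycle_char n t - exp ((\<i> * of_real t - of_real (t\<^sup>2 / 2)) * of_real (ln (real n))))
       \<le> K * (\<bar>t\<bar> + ln (real n) * \<bar>t\<bar> ^ 3) * exp (- (t\<^sup>2 / 16) * ln (real n))"
proof -
  \<comment> \<open>On the interval |t|^3 \<le> 16 |t| and 8 t^2 \<le> 32 |t|; the last summand pays
    for the passage from \<open>harm n\<close> to \<open>ln n\<close>.\<close>
  define K :: real where "K = exp 3 * (16 + 32 * exp 6) + 2 * exp 6"
  have "norm (cycle_char n t - exp ((\<i> * of_real t - of_real (t\<^sup>2 / 2)) * of_real (ln (real n))))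
       \<le> K * (\<bar>t\<bar> + ln (real n) * \<bar>t\<bar> ^ 3) * exp (- (t\<^sup>2 / 16) * ln (real n))"
    if n: "n \<ge> 1" and t: "\<bar>t\<bar> \<le> pi" for n t
  proof -
    define L where "L = ln (real n)"
    define w where "w = \<i> * complex_of_real t - of_real (t\<^sup>2 / 2)"
    define E where "E = exp (- (t\<^sup>2 / 16) * L)"
    have L: "L \<ge> 0" using n by (simp add: L_def)
    have t2: "t\<^sup>2 \<le> 12" using t by (rule sq_le_of_le_pi)
    have t1: "\<bar>t\<bar> \<le> 4" using t pi_less_4 by linarith
    have "norm (exp (w * of_real (harm n)) - exp (w * of_real L)) =
            exp (- (t\<^sup>2 / 2) * L) * norm (exp (w * of_real (harm n - L)) - 1)"
    proof -
      have "exp (w * of_real (harm n)) - exp (w * of_real L) =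
              exp (w * of_real L) * (exp (w * of_real (harm n - L)) - 1)"
        by (simp add: algebra_simps flip: exp_add)
      thus ?thesis by (simp add: norm_mult norm_exp_eq_Re w_def)
    qed
    also have "\<dots> \<le> E * (exp 6 * (2 * \<bar>t\<bar>))"
    proof (rule mult_mono)
      show "exp (- (t\<^sup>2 / 2) * L) \<le> E" using L by (simp add: E_def field_simps mult_left_mono)
    next
      define d where "d = harm n - L"
      have d: "0 \<le> d" "d \<le> 1"
        using harm_ge_ln'[OF n] harm_le_ln[OF n] by (auto simp: d_def L_def)
      have "norm (exp (w * of_real d) - 1) \<le> exp \<bar>Re (w * of_real d)\<bar> * norm (w * of_real d)"
        using Taylor_exp[of "w * of_real d" 0] by simp
      also have "\<dots> \<le> exp 6 * (2 * \<bar>t\<bar> * 1)"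
      proof (rule mult_mono)
        have "t\<^sup>2 * d \<le> 12 * 1" using t2 d by (intro mult_mono) auto
        thus "exp \<bar>Re (w * of_real d)\<bar> \<le> exp 6"
          using d by (simp add: w_def abs_mult)
        have "norm w \<le> 2 * \<bar>t\<bar>" unfolding w_def by (rule norm_gaussian_exponent_le[OF t])
        thus "norm (w * of_real d) \<le> 2 * \<bar>t\<bar> * 1"
          using d unfolding norm_mult by (intro mult_mono) auto
      qed auto
      finally show "norm (exp (w * of_real (harm n - L)) - 1) \<le> exp 6 * (2 * \<bar>t\<bar>)"
        by (simp add: d_def)
    qed (auto simp: E_def)
    finally have 1: "norm (exp (w * of_real (harm n)) - exp (w * of_real L)) \<le> E * (exp 6 * (2 * \<bar>t\<bar>))" .
    have 2: "norm (cycle_char n t - exp (w * of_real (harm n))) \<le>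
            exp 3 * E * (\<bar>t\<bar> ^ 3 * (L + 1) + 8 * exp 6 * t\<^sup>2)"
      using cycle_char_approx_harm[OF t n] by (simp add: E_def L_def w_def)
    also have "\<dots> \<le> exp 3 * E * ((16 + 32 * exp 6) * (\<bar>t\<bar> + L * \<bar>t\<bar> ^ 3))"
    proof (rule mult_left_mono)
      have "\<bar>t\<bar> ^ 3 = \<bar>t\<bar> * t\<^sup>2" by (simp add: eval_nat_numeral)
      also have "\<dots> \<le> \<bar>t\<bar> * 16" using t2 by (intro mult_left_mono) auto
      finally have a: "\<bar>t\<bar> ^ 3 \<le> 16 * \<bar>t\<bar>" by simp
      have "t\<^sup>2 = \<bar>t\<bar> * \<bar>t\<bar>" by (simp add: power2_eq_square)
      also have "\<dots> \<le> 4 * \<bar>t\<bar>" using t1 by (intro mult_right_mono) auto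
      finally have b: "8 * exp 6 * t\<^sup>2 \<le> 8 * exp 6 * (4 * \<bar>t\<bar>)" by (intro mult_left_mono) auto
      have c: "1 * (L * \<bar>t\<bar> ^ 3) \<le> (16 + 32 * exp 6) * (L * \<bar>t\<bar> ^ 3)"
        using L by (intro mult_right_mono) (auto intro: order.trans[of _ 16])
      show "\<bar>t\<bar> ^ 3 * (L + 1) + 8 * exp 6 * t\<^sup>2 \<le> (16 + 32 * exp 6) * (\<bar>t\<bar> + L * \<bar>t\<bar> ^ 3)"
      proof -
        have "\<bar>t\<bar> ^ 3 * (L + 1) + 8 * exp 6 * t\<^sup>2 =
                1 * (L * \<bar>t\<bar> ^ 3) + \<bar>t\<bar> ^ 3 + 8 * exp 6 * t\<^sup>2"
          by (simp add: algebra_simps)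
        also have "\<dots> \<le> (16 + 32 * exp 6) * (L * \<bar>t\<bar> ^ 3) + 16 * \<bar>t\<bar> + 8 * exp 6 * (4 * \<bar>t\<bar>)"
          by (intro add_mono a b c)
        also have "\<dots> = (16 + 32 * exp 6) * (\<bar>t\<bar> + L * \<bar>t\<bar> ^ 3)"
          by (simp add: algebra_simps)
        finally show ?thesis .
      qed
    qed (auto simp: E_def)
    finally have "norm (cycle_char n t - exp (w * of_real L)) \<le>
       exp 3 * E * ((16 + 32 * exp 6) * (\<bar>t\<bar> + L * \<bar>t\<bar> ^ 3)) + E * (exp 6 * (2 * \<bar>t\<bar>))"
      using 1 norm_triangle_ineq[of "cycle_char n t - exp (w * of_real (harm n))"
                 "exp (w * of_real (harm n)) - exp (w * of_real L)"] by simp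
    also have "\<dots> \<le> exp 3 * E * ((16 + 32 * exp 6) * (\<bar>t\<bar> + L * \<bar>t\<bar> ^ 3)) +
                    E * (exp 6 * (2 * (\<bar>t\<bar> + L * \<bar>t\<bar> ^ 3)))"
      using L by (intro add_left_mono mult_left_mono) (auto simp: E_def)
    also have "\<dots> = K * (\<bar>t\<bar> + L * \<bar>t\<bar> ^ 3) * E"
      by (simp add: K_def algebra_simps)
    finally show ?thesis by (simp add: E_def L_def w_def)
  qed
  moreover have "K \<ge> 0" by (simp add: K_def)
  ultimately show ?thesis by blast
qed

subsection \<open>Fourier inversion\<close>

definition cycle_prob_int :: "nat \<Rightarrow> int \<Rightarrow> real" where
  "cycle_prob_int n k = (if k \<ge> 0 then cycle_prob n (nat k) else 0)"

lemma integral_iexp_period: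
  "has_bochner_integral lborel (\<lambda>t. indicator {-pi..pi} t *\<^sub>R iexp (t * of_int m))
     (if m = 0 then of_real (2 * pi) else 0)"
proof -
  have cont: "continuous_on {-pi..pi} (\<lambda>t. iexp (t * of_int m))"
    by (intro continuous_intros)
  have int: "integrable lborel (\<lambda>t. indicator {-pi..pi} t *\<^sub>R iexp (t * of_int m))"
    using borel_integrable_atLeastAtMost'[OF cont] by (simp add: set_integrable_def)
  have "integral\<^sup>L lborel (\<lambda>t. indicator {-pi..pi} t *\<^sub>R iexp (t * of_int m)) =
          (if m = 0 then of_real (2 * pi) else 0)"
  proof (cases "m = 0")
    case True
    have "integral\<^sup>L lborel (\<lambda>t. indicator {-pi..pi} t *\<^sub>R iexp (t * of_int m)) =
            of_real pi - of_real (- pi)"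
      by (rule integral_FTC_atLeastAtMost[OF _ _ cont])
         (auto simp: True intro!: derivative_eq_intros has_vector_derivative_of_real)
    thus ?thesis using True by simp
  next
    case False
    let ?F = "\<lambda>t. iexp (t * of_int m) / (\<i> * of_int m)"
    have "integral\<^sup>L lborel (\<lambda>t. indicator {-pi..pi} t *\<^sub>R iexp (t * of_int m)) = ?F pi - ?F (- pi)"
    proof (rule integral_FTC_atLeastAtMost[OF _ _ cont])
      fix x :: real
      have "((\<lambda>z. exp (\<i> * (z * of_int m)) / (\<i> * of_int m)) has_field_derivative
              iexp (x * of_int m)) (at (of_real x))"
        using False by (auto intro!: derivative_eq_intros simp: mult_ac)
      from has_vector_derivative_real_field[OF this]
      show "(?F has_vector_derivative iexp (x * of_int m)) (at x within {-pi..pi})"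
        by simp
    qed auto
    \<comment> \<open>The two arguments differ by m times the period 2 pi i.\<close>
    also have "iexp (pi * of_int m) = iexp (- pi * of_int m)"
      unfolding exp_eq by (intro exI[of _ m]) (simp add: algebra_simps)
    finally show ?thesis using False by simp
  qed
  with int show ?thesis by (simp add: has_bochner_integral_iff)
qed

text \<open>Orthogonality leaves only the term \<open>j = k\<close>; for \<open>k\<close> outside
  the range no term survives and the right-hand side is 0 as well.\<close>

lemma cycle_prob_fourier:
  "has_bochner_integral lborel (\<lambda>t. indicator {-pi..pi} t *\<^sub>R (cycle_char n t * iexp (- t * of_int k)))
     (of_real (2 * pi * cycle_prob_int n k))"
proof -
  have "has_bochner_integral lborel
     (\<lambda>t. \<Sum>j\<le>n. of_real (cycle_prob n j) * (indicator {-pi..pi} t *\<^sub>R iexp (t * of_int (int j - k))))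
     (\<Sum>j\<le>n. of_real (cycle_prob n j) * (if int j - k = 0 then of_real (2 * pi) else 0))"
    by (intro has_bochner_integral_sum has_bochner_integral_mult_right integral_iexp_period)
  also have "(\<lambda>t. \<Sum>j\<le>n. of_real (cycle_prob n j) * (indicator {-pi..pi} t *\<^sub>R iexp (t * of_int (int j - k)))) =
     (\<lambda>t. indicator {-pi..pi} t *\<^sub>R (cycle_char n t * iexp (- t * of_int k)))"
    unfolding cycle_char_def sum_distrib_right scaleR_sum_right
    by (intro ext sum.cong refl) (simp add: ring_distribs flip: exp_add)
  also have "(\<Sum>j\<le>n. of_real (cycle_prob n j) * (if int j - k = 0 then of_real (2 * pi) else 0)) =
     (\<Sum>j\<le>n. if j = nat k \<and> k \<ge> 0 then complex_of_real (2 * pi * cycle_prob n j) else 0)"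
    by (intro sum.cong) auto
  also have "\<dots> = of_real (2 * pi * cycle_prob_int n k)"
    by (cases "k \<ge> 0") (auto simp: cycle_prob_int_def cycle_prob_gt)
  finally show ?thesis .
qed

text \<open>The integrand is exp (- L t^2 / 2) times \<open>iexp ((L - y) * t)\<close>, so the
  substitution x = sqrt L t produces the characteristic function of the standard normal law at
  \<open>s\<close>. Integrating over the whole line gives an exact value.\<close>

lemma gaussian_fourier:
  fixes L y :: real
  assumes "L > 0"
  shows "has_bochner_integral lborel
     (\<lambda>t. exp ((\<i> * of_real t - of_real (t\<^sup>2 / 2)) * of_real L) * iexp (- t * y))
     (of_real (sqrt (2 * pi / L) * exp (- ((y - L)\<^sup>2 / (2 * L)))))"
proof -
  define s where "s = (L - y) / sqrt L"
  interpret real_distribution std_normal_distribution by (rule real_dist_normal_dist)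
  have "integrable std_normal_distribution (\<lambda>x. iexp (s * x))"
    by (rule integrable_iexp) auto
  hence 1: "integrable lborel (\<lambda>x. std_normal_density x *\<^sub>R iexp (s * x))"
    by (subst (asm) integrable_density) auto
  have "char std_normal_distribution s = integral\<^sup>L lborel (\<lambda>x. std_normal_density x *\<^sub>R iexp (s * x))"
    unfolding char_def by (subst integral_density) auto
  with 1 have "has_bochner_integral lborel (\<lambda>x. std_normal_density x *\<^sub>R iexp (s * x))
                 (of_real (exp (- (s\<^sup>2) / 2)))"
    by (simp add: has_bochner_integral_iff char_std_normal_distribution)
  hence "has_bochner_integral lborel (\<lambda>t. std_normal_density (0 + sqrt L * t) *\<^sub>R iexp (s * (0 + sqrt L * t)))
                 (of_real (exp (- (s\<^sup>2) / 2)) /\<^sub>R \<bar>sqrt L\<bar>)"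
    by (subst (asm) lborel_has_bochner_integral_real_affine_iff[where c = "sqrt L" and t = 0])
       (use assms in auto)
  hence "has_bochner_integral lborel (\<lambda>t. of_real (sqrt (2 * pi)) * (std_normal_density (0 + sqrt L * t) *\<^sub>R iexp (s * (0 + sqrt L * t))))
                 (of_real (sqrt (2 * pi)) * (of_real (exp (- (s\<^sup>2) / 2)) /\<^sub>R \<bar>sqrt L\<bar>))"
    by (rule has_bochner_integral_mult_right)
  also have "(\<lambda>t. complex_of_real (sqrt (2 * pi)) * (std_normal_density (0 + sqrt L * t) *\<^sub>R iexp (s * (0 + sqrt L * t)))) =
             (\<lambda>t. exp ((\<i> * of_real t - of_real (t\<^sup>2 / 2)) * of_real L) * iexp (- t * y))"
  proof
    fix t :: real
    have sL: "s * (0 + sqrt L * t) = (L - y) * t"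
      using assms by (simp add: s_def)
    have "sqrt (2 * pi) * std_normal_density (0 + sqrt L * t) = exp (- (t\<^sup>2 / 2) * L)"
      using assms by (simp add: std_normal_density_def power_mult_distrib real_sqrt_mult field_simps)
    hence "complex_of_real (sqrt (2 * pi)) * (std_normal_density (0 + sqrt L * t) *\<^sub>R iexp (s * (0 + sqrt L * t))) =
           of_real (exp (- (t\<^sup>2 / 2) * L)) * iexp ((L - y) * t)"
      unfolding sL scaleR_conv_of_real mult.assoc[symmetric] of_real_mult[symmetric] by simp
    also have "\<dots> = exp ((\<i> * of_real t - of_real (t\<^sup>2 / 2)) * of_real L) * iexp (- t * y)"
      by (simp add: algebra_simps flip: exp_of_real exp_add)
    finally show "complex_of_real (sqrt (2 * pi)) * (std_normal_density (0 + sqrt L * t) *\<^sub>R iexp (s * (0 + sqrt L * t))) =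
       exp ((\<i> * of_real t - of_real (t\<^sup>2 / 2)) * of_real L) * iexp (- t * y)" .
  qed
  also have "complex_of_real (sqrt (2 * pi)) * (of_real (exp (- (s\<^sup>2) / 2)) /\<^sub>R \<bar>sqrt L\<bar>) =
     of_real (sqrt (2 * pi / L) * exp (- ((y - L)\<^sup>2 / (2 * L))))"
  proof -
    have "s\<^sup>2 / 2 = (y - L)\<^sup>2 / (2 * L)"
      using assms by (simp add: s_def power_divide power2_commute)
    thus ?thesis using assms
      by (simp add: scaleR_conv_of_real real_sqrt_divide field_simps)
  qed
  finally show ?thesis .
qed

lemma integrable_error_kernel:
  "integrable lborel (\<lambda>u::real. (\<bar>u\<bar> + \<bar>u\<bar> ^ 3) * exp (- (u\<^sup>2 / 16)))"
proof -
  \<comment> \<open>The weight exp (- u^2 / 16) is \<open>c\<close> times the centred normal density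
    of variance 8.\<close>
  define c where "c = sqrt (2 * pi * 8)"
  have "integrable lborel (\<lambda>u. c * (normal_density 0 (sqrt 8) u * \<bar>u - 0\<bar> ^ 1)
                              + c * (normal_density 0 (sqrt 8) u * \<bar>u - 0\<bar> ^ 3))"
    by (intro Bochner_Integration.integrable_add integrable_mult_right integrable_normal_moment_abs) auto
  also have "(\<lambda>u. c * (normal_density 0 (sqrt 8) u * \<bar>u - 0\<bar> ^ 1)
                              + c * (normal_density 0 (sqrt 8) u * \<bar>u - 0\<bar> ^ 3)) =
             (\<lambda>u. (\<bar>u\<bar> + \<bar>u\<bar> ^ 3) * exp (- (u\<^sup>2 / 16)))"
  proof
    fix u
    have "c * normal_density 0 (sqrt 8) u = exp (- (u\<^sup>2 / 16))"
      by (simp add: normal_density_def c_def)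
    thus "c * (normal_density 0 (sqrt 8) u * \<bar>u - 0\<bar> ^ 1)
           + c * (normal_density 0 (sqrt 8) u * \<bar>u - 0\<bar> ^ 3) = (\<bar>u\<bar> + \<bar>u\<bar> ^ 3) * exp (- (u\<^sup>2 / 16))"
      by (simp only: mult.assoc[symmetric] diff_zero power_one_right) (simp add: algebra_simps)
  qed
  finally show ?thesis .
qed

text \<open>With u = sqrt L t the polynomial factor contributes L^(-1/2) and dt another
  L^(-1/2).\<close>

lemma error_integral_scaled:
  "\<exists>J::real\<ge>0. \<forall>L>0. has_bochner_integral lborel
     (\<lambda>t. (\<bar>t\<bar> + L * \<bar>t\<bar> ^ 3) * exp (- (t\<^sup>2 / 16) * L)) (J / L)"
proof -
  define h where "h u = (\<bar>u\<bar> + \<bar>u\<bar> ^ 3) * exp (- (u\<^sup>2 / 16))" for u :: real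
  define J where "J = integral\<^sup>L lborel h"
  have h: "has_bochner_integral lborel h J"
    using integrable_error_kernel unfolding J_def h_def by (simp add: has_bochner_integral_iff)
  have "has_bochner_integral lborel (\<lambda>t. (\<bar>t\<bar> + L * \<bar>t\<bar> ^ 3) * exp (- (t\<^sup>2 / 16) * L)) (J / L)"
    if L: "L > 0" for L
  proof -
    have "has_bochner_integral lborel (\<lambda>t. h (0 + sqrt L * t)) (J /\<^sub>R \<bar>sqrt L\<bar>)"
      using h by (subst (asm) lborel_has_bochner_integral_real_affine_iff[where c = "sqrt L" and t = 0])
         (use L in auto)
    hence "has_bochner_integral lborel (\<lambda>t. (1 / sqrt L) * h (0 + sqrt L * t)) ((1 / sqrt L) * (J /\<^sub>R \<bar>sqrt L\<bar>))"
      by (rule has_bochner_integral_mult_right)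
    also have "(\<lambda>t. (1 / sqrt L) * h (0 + sqrt L * t)) =
        (\<lambda>t. (\<bar>t\<bar> + L * \<bar>t\<bar> ^ 3) * exp (- (t\<^sup>2 / 16) * L))"
    proof
      fix t
      have "sqrt L * sqrt L = L" using L by simp
      hence "\<bar>sqrt L * t\<bar> + \<bar>sqrt L * t\<bar> ^ 3 = sqrt L * (\<bar>t\<bar> + L * \<bar>t\<bar> ^ 3)"
        using L by (simp add: abs_mult power_mult_distrib eval_nat_numeral algebra_simps)
      moreover have "(sqrt L * t)\<^sup>2 = L * t\<^sup>2" using L by (simp add: power_mult_distrib)
      ultimately show "(1 / sqrt L) * h (0 + sqrt L * t) = (\<bar>t\<bar> + L * \<bar>t\<bar> ^ 3) * exp (- (t\<^sup>2 / 16) * L)"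
        using L by (simp add: h_def mult_ac)
    qed
    also have "(1 / sqrt L) * (J /\<^sub>R \<bar>sqrt L\<bar>) = J / L"
      using L by (simp add: field_simps)
    finally show ?thesis .
  qed
  moreover have "J \<ge> 0" unfolding J_def h_def by (intro Bochner_Integration.integral_nonneg) auto
  ultimately show ?thesis by blast
qed

text \<open>Subtract the two Fourier integrals. One kernel bounds the integrand everywhere: with
  constant K on [-pi, pi], and with constant 1 outside, where only the Gaussian is left; hence K +
  1. Multiplication by sqrt L / (2 pi) turns J / L into the rate L^(-1/2).\<close>

theorem cycle_prob_local_limit:
  "\<exists>C\<ge>0. \<forall>n\<ge>2. \<forall>k. \<bar>sqrt (ln (real n)) * cycle_prob_int n k
      - 1 / sqrt (2 * pi) * exp (- ((real_of_int k - ln (real n))\<^sup>2 / (2 * ln (real n))))\<bar>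
        \<le> C / sqrt (ln (real n))"
proof -
  obtain K where K: "K \<ge> 0" "\<And>n t. n \<ge> 1 \<Longrightarrow> \<bar>t\<bar> \<le> pi \<Longrightarrow>
     norm (cycle_char n t - exp ((\<i> * of_real t - of_real (t\<^sup>2 / 2)) * of_real (ln (real n))))
       \<le> K * (\<bar>t\<bar> + ln (real n) * \<bar>t\<bar> ^ 3) * exp (- (t\<^sup>2 / 16) * ln (real n))"
    using cycle_char_approx by blast
  obtain J :: real where J: "J \<ge> 0" "\<And>L. L > 0 \<Longrightarrow> has_bochner_integral lborel
     (\<lambda>t. (\<bar>t\<bar> + L * \<bar>t\<bar> ^ 3) * exp (- (t\<^sup>2 / 16) * L)) (J / L)"
    using error_integral_scaled by blast
  define C where "C = (K + 1) * J / (2 * pi)"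
  have "\<bar>sqrt (ln (real n)) * cycle_prob_int n k
      - 1 / sqrt (2 * pi) * exp (- ((real_of_int k - ln (real n))\<^sup>2 / (2 * ln (real n))))\<bar>
        \<le> C / sqrt (ln (real n))" if n: "n \<ge> 2" for n k
  proof -
    define L where "L = ln (real n)"
    have L: "L > 0" using n by (simp add: L_def)
    define f where "f t = indicator {-pi..pi} t *\<^sub>R (cycle_char n t * iexp (- t * of_int k))" for t
    define g where "g t = exp ((\<i> * of_real t - of_real (t\<^sup>2 / 2)) * of_real L) * iexp (- t * of_int k)" for t
    define e where "e t = (\<bar>t\<bar> + L * \<bar>t\<bar> ^ 3) * exp (- (t\<^sup>2 / 16) * L)" for t
    define G where "G = exp (- ((real_of_int k - L)\<^sup>2 / (2 * L)))"
    have f: "has_bochner_integral lborel f (of_real (2 * pi * cycle_prob_int n k))"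
      unfolding f_def by (rule cycle_prob_fourier)
    have g: "has_bochner_integral lborel g (of_real (sqrt (2 * pi / L) * G))"
      unfolding g_def G_def by (rule gaussian_fourier[OF L])
    have e: "has_bochner_integral lborel (\<lambda>t. (K + 1) * e t) ((K + 1) * (J / L))"
      unfolding e_def by (intro has_bochner_integral_mult_right J L)
    have le: "norm (f t - g t) \<le> (K + 1) * e t" for t
    proof (cases "\<bar>t\<bar> \<le> pi")
      case True
      hence "t \<in> {-pi..pi}" by auto
      hence "f t - g t = (cycle_char n t - exp ((\<i> * of_real t - of_real (t\<^sup>2 / 2)) * of_real L)) * iexp (- t * of_int k)"
        by (simp add: f_def g_def algebra_simps)
      hence "norm (f t - g t) = norm (cycle_char n t - exp ((\<i> * of_real t - of_real (t\<^sup>2 / 2)) * of_real L))"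
        by (simp add: norm_mult norm_exp_eq_Re)
      also have "\<dots> \<le> K * e t"
        using K(2)[of n t] n True by (simp add: L_def e_def mult.assoc)
      also have "\<dots> \<le> (K + 1) * e t"
        using L by (intro mult_right_mono) (auto simp: e_def)
      finally show ?thesis .
    next
      case False
      hence "t \<notin> {-pi..pi}" by auto
      hence "norm (f t - g t) = exp (- (t\<^sup>2 / 2) * L)"
        by (simp add: f_def g_def norm_mult norm_exp_eq_Re)
      also have "\<dots> = 1 * exp (- (t\<^sup>2 / 2) * L)" by simp
      \<comment> \<open>Outside [-pi, pi] the polynomial factor exceeds 1, so the error kernel also
        controls the Gaussian tail.\<close>
      also have "\<dots> \<le> (\<bar>t\<bar> + L * \<bar>t\<bar> ^ 3) * exp (- (t\<^sup>2 / 16) * L)"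
      proof (rule mult_mono)
        have "1 \<le> \<bar>t\<bar>" using False pi_gt3 by linarith
        moreover have "L * \<bar>t\<bar> ^ 3 \<ge> 0" using L by simp
        ultimately show "1 \<le> \<bar>t\<bar> + L * \<bar>t\<bar> ^ 3" by linarith
        have "L * t\<^sup>2 \<ge> 0" using L by simp
        thus "exp (- (t\<^sup>2 / 2) * L) \<le> exp (- (t\<^sup>2 / 16) * L)" by simp
      qed (use L in auto)
      also have "\<dots> = 1 * e t" by (simp add: e_def)
      also have "\<dots> \<le> (K + 1) * e t"
        using L K by (intro mult_right_mono) (auto simp: e_def)
      finally show ?thesis .
    qed
    have "norm (integral\<^sup>L lborel (\<lambda>t. f t - g t)) \<le> integral\<^sup>L lborel (\<lambda>t. (K + 1) * e t)"
      by (rule Bochner_Integration.integral_norm_bound_integral)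
         (use f g e le in \<open>auto simp: has_bochner_integral_iff intro!: Bochner_Integration.integrable_diff\<close>)
    also have "integral\<^sup>L lborel (\<lambda>t. f t - g t) =
                 of_real (2 * pi * cycle_prob_int n k - sqrt (2 * pi / L) * G)"
      using has_bochner_integral_integral_eq[OF has_bochner_integral_diff[OF f g]] by simp
    also have "integral\<^sup>L lborel (\<lambda>t. (K + 1) * e t) = (K + 1) * (J / L)"
      by (rule has_bochner_integral_integral_eq[OF e])
    finally have "\<bar>2 * pi * cycle_prob_int n k - sqrt (2 * pi / L) * G\<bar> \<le> (K + 1) * (J / L)"
      by (simp only: norm_of_real)
    hence "sqrt L / (2 * pi) * \<bar>2 * pi * cycle_prob_int n k - sqrt (2 * pi / L) * G\<bar>
             \<le> sqrt L / (2 * pi) * ((K + 1) * (J / L))"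
      using L by (intro mult_left_mono) auto
    also have "sqrt L / (2 * pi) * ((K + 1) * (J / L)) = C * (sqrt L / L)"
      by (simp add: C_def)
    also have "sqrt L / L = 1 / sqrt L"
      using L by (simp add: field_simps)
    also have "sqrt L / (2 * pi) * \<bar>2 * pi * cycle_prob_int n k - sqrt (2 * pi / L) * G\<bar> =
               \<bar>sqrt L / (2 * pi) * (2 * pi * cycle_prob_int n k - sqrt (2 * pi / L) * G)\<bar>"
      using L by (simp add: abs_mult)
    also have "sqrt L / (2 * pi) * (2 * pi * cycle_prob_int n k - sqrt (2 * pi / L) * G) =
               sqrt L * cycle_prob_int n k - 1 / sqrt (2 * pi) * G"
    proof -
      have "sqrt L * sqrt (2 * pi / L) = sqrt (2 * pi)"
        using L by (simp flip: real_sqrt_mult)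
      moreover have "sqrt (2 * pi) / (2 * pi) = 1 / sqrt (2 * pi)"
        by (simp add: field_simps)
      ultimately have "sqrt L / (2 * pi) * sqrt (2 * pi / L) = 1 / sqrt (2 * pi)"
        by simp
      thus ?thesis by (simp add: right_diff_distrib flip: mult.assoc)
    qed
    finally show ?thesis by (simp add: L_def G_def)
  qed
  moreover have "C \<ge> 0" using K J by (simp add: C_def)
  ultimately show ?thesis by blast
qed

subsection \<open>Transfer to the Matsunaga numbers\<close>

lemma cycle_prob_le_1: "cycle_prob n k \<le> 1"
proof (cases "k \<le> n")
  case True
  hence "cycle_prob n k \<le> (\<Sum>k\<le>n. cycle_prob n k)"
    by (intro member_le_sum) (auto simp: cycle_prob_nonneg)
  thus ?thesis by (simp add: sum_cycle_prob)
qed (simp add: cycle_prob_gt)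

lemma cycle_prob_int_bounds: "0 \<le> cycle_prob_int n k" "cycle_prob_int n k \<le> 1"
  by (auto simp: cycle_prob_int_def cycle_prob_nonneg cycle_prob_le_1)

text \<open>Write a - p S as (a - b p) + p (b - S), at most 2 d b p in absolute value, and divide by
  S \<ge> b / 2.\<close>

lemma normalized_weight_diff:
  fixes a b p d S :: real
  assumes "\<bar>a - b * p\<bar> \<le> d * (b * p)" "\<bar>S - b\<bar> \<le> d * b" "b > 0" "p \<ge> 0" "0 \<le> d" "d \<le> 1 / 2"
  shows "\<bar>a / S - p\<bar> \<le> 4 * d * p"
proof -
  have "d * b \<le> 1 / 2 * b" using assms by (intro mult_right_mono) auto
  hence S: "S \<ge> b / 2" using assms(2) by linarith
  hence S0: "S > 0" using assms by linarith
  have "\<bar>a - p * S\<bar> \<le> \<bar>a - b * p\<bar> + \<bar>p * (b - S)\<bar>"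
    by (simp add: algebra_simps)
  also have "\<dots> \<le> d * (b * p) + p * (d * b)"
    using assms unfolding abs_mult by (intro add_mono mult_mono) (auto simp: abs_minus_commute)
  also have "\<dots> = 4 * d * p * (b / 2)" by simp
  also have "\<dots> \<le> 4 * d * p * S" using assms S by (intro mult_left_mono) auto
  finally have "\<bar>a - p * S\<bar> / S \<le> 4 * d * p" using S0 by (simp add: divide_le_eq)
  moreover have "\<bar>a - p * S\<bar> / S = \<bar>a / S - p\<bar>"
  proof -
    have "a / S - p = (a - p * S) / S" using S0 by (simp add: field_simps)
    thus ?thesis using S0 by simp
  qed
  ultimately show ?thesis by simp
qed

lemma matsunaga_pmf_approx:
  "\<exists>C>0. \<forall>\<^sub>F n in at_top. \<forall>k. \<bar>pmf (matsunaga_pmf n) k - cycle_prob_int n k\<bar>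
      \<le> C / sqrt (real n) * cycle_prob_int n k"
proof -
  obtain C where C: "C \<ge> 0" "\<And>n k. n \<ge> 145 \<Longrightarrow> k \<ge> 1 \<Longrightarrow>
      \<bar>\<bar>matsunaga n (int k)\<bar> - matsunaga_main n k\<bar> \<le> C / sqrt (real n) * matsunaga_main n k"
    using matsunaga_approx by blast
  have "\<forall>\<^sub>F n in at_top. C / sqrt (real n) < 1 / 2"
    by real_asymp
  moreover have "\<forall>\<^sub>F n :: nat in at_top. n \<ge> 145"
    by (rule eventually_ge_at_top)
  ultimately have "\<forall>\<^sub>F n in at_top. \<forall>k. \<bar>pmf (matsunaga_pmf n) k - cycle_prob_int n k\<bar>
      \<le> (4 * C + 1) / sqrt (real n) * cycle_prob_int n k"
  proof eventually_elim
    case (elim n)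
    define d where "d = C / sqrt (real n)"
    \<comment> \<open>The total mass of the main terms, since the Stirling numbers in a row sum to
      n!.\<close>
    define b where "b = singleton_free_bell n * fact n"
    define S where "S = (\<Sum>j=1..int n. \<bar>matsunaga n j\<bar>)"
    have b: "b > 0" unfolding b_def using singleton_free_bell_pos[of n] elim by simp
    have main: "matsunaga_main n k = b * cycle_prob n k" for k
      by (simp add: matsunaga_main_def b_def cycle_prob_def)
    have S_eq: "S = (\<Sum>k=1..n. \<bar>matsunaga n (int k)\<bar>)"
      unfolding S_def by (rule sum.reindex_bij_witness[of _ int nat]) auto
    have "(\<Sum>k=1..n. cycle_prob n k) = (\<Sum>k\<le>n. cycle_prob n k)"
      using elim by (intro sum.mono_neutral_left) (auto simp: not_le less_Suc_eq cycle_prob_0)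
    hence sum1: "(\<Sum>k=1..n. cycle_prob n k) = 1" by (simp add: sum_cycle_prob)
    have "\<bar>S - b\<bar> = \<bar>\<Sum>k=1..n. \<bar>matsunaga n (int k)\<bar> - matsunaga_main n k\<bar>"
      unfolding S_eq sum_subtractf main sum_distrib_left[symmetric] sum1 by simp
    also have "\<dots> \<le> (\<Sum>k=1..n. d * matsunaga_main n k)"
      unfolding d_def by (intro order.trans[OF sum_abs] sum_mono C(2)) (use elim in auto)
    also have "\<dots> = d * b"
      unfolding main sum_distrib_left[symmetric] sum1 by simp
    finally have S: "\<bar>S - b\<bar> \<le> d * b" .
    have "\<bar>pmf (matsunaga_pmf n) k - cycle_prob_int n k\<bar> \<le> 4 * d * cycle_prob_int n k" for k
    proof (cases "1 \<le> k \<and> k \<le> int n")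
      case True
      then obtain j where k: "k = int j" by (metis nonneg_int_cases order.trans zero_le_one)
      have j: "1 \<le> j" "j \<le> n" using True k by auto
      have "\<bar>\<bar>matsunaga n (int j)\<bar> / S - cycle_prob n j\<bar> \<le> 4 * d * cycle_prob n j"
      proof (rule normalized_weight_diff[OF _ S b])
        show "\<bar>\<bar>matsunaga n (int j)\<bar> - b * cycle_prob n j\<bar> \<le> d * (b * cycle_prob n j)"
          using C(2)[of n j] j elim by (simp add: main d_def)
      qed (use elim C(1) in \<open>auto simp: d_def cycle_prob_nonneg\<close>)
      thus ?thesis
        using elim j by (simp add: pmf_matsunaga_pmf k cycle_prob_int_def S_def)
    next
      case False
      have "cycle_prob n 0 = 0" using elim by (intro cycle_prob_0) auto
      with False have "cycle_prob_int n k = 0"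
        by (cases "k = 0") (auto simp: cycle_prob_int_def intro!: cycle_prob_gt)
      with False elim show ?thesis by (auto simp: pmf_matsunaga_pmf)
    qed
    \<comment> \<open>The added 1 makes the constant strictly positive even when
      \<open>C = 0\<close>.\<close>
    moreover have "4 * d * cycle_prob_int n k \<le> (4 * C + 1) / sqrt (real n) * cycle_prob_int n k" for k
      by (intro mult_right_mono cycle_prob_int_bounds) (simp add: d_def divide_right_mono)
    ultimately show ?case using order.trans by blast
  qed
  thus ?thesis using C(1) by (intro exI[of _ "4 * C + 1"]) auto
qed

section \<open>Mean and variance of the Matsunaga law\<close>

lemma expectation_matsunaga_pmf:
  fixes f :: "int \<Rightarrow> real"
  assumes "n \<ge> 2"
  shows "measure_pmf.expectation (matsunaga_pmf n) f = (\<Sum>k\<le>n. f (int k) * pmf (matsunaga_pmf n) (int k))"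
proof -
  \<comment> \<open>Index 0 has probability 0; it is included to match the range of the cycle
    sums.\<close>
  have "measure_pmf.expectation (matsunaga_pmf n) f = (\<Sum>k\<in>int ` {..n}. f k * pmf (matsunaga_pmf n) k)"
  proof (rule integral_measure_pmf_real)
    fix k assume "k \<in> set_pmf (matsunaga_pmf n)"
    hence "1 \<le> k \<and> k \<le> int n"
      using assms by (auto simp: set_pmf_iff pmf_matsunaga_pmf split: if_splits)
    thus "k \<in> int ` {..n}" by (intro image_eqI[of _ _ "nat k"]) auto
  qed auto
  thus ?thesis by (simp add: sum.reindex)
qed

text \<open>For nonnegative \<open>f\<close> a pointwise relative error is inherited by the
  expectation, with no loss from the size of \<open>f\<close>.\<close>

lemma expectation_matsunaga_pmf_approx:
  fixes f :: "int \<Rightarrow> real"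
  assumes "n \<ge> 2" "\<And>k. \<bar>pmf (matsunaga_pmf n) k - cycle_prob_int n k\<bar> \<le> d * cycle_prob_int n k"
    and "\<And>k. k \<ge> 0 \<Longrightarrow> f k \<ge> 0"
  shows "\<bar>measure_pmf.expectation (matsunaga_pmf n) f - (\<Sum>k\<le>n. f (int k) * cycle_prob n k)\<bar>
           \<le> d * (\<Sum>k\<le>n. f (int k) * cycle_prob n k)"
proof -
  have "\<bar>measure_pmf.expectation (matsunaga_pmf n) f - (\<Sum>k\<le>n. f (int k) * cycle_prob n k)\<bar>
     = \<bar>\<Sum>k\<le>n. f (int k) * (pmf (matsunaga_pmf n) (int k) - cycle_prob_int n (int k))\<bar>"
    by (simp add: expectation_matsunaga_pmf assms(1) cycle_prob_int_def right_diff_distrib sum_subtractf)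
  also have "\<dots> \<le> (\<Sum>k\<le>n. f (int k) * (d * cycle_prob_int n (int k)))"
    using assms(2,3) by (intro order.trans[OF sum_abs] sum_mono) (auto simp: abs_mult intro!: mult_left_mono)
  also have "\<dots> = d * (\<Sum>k\<le>n. f (int k) * cycle_prob n k)"
    by (simp add: cycle_prob_int_def sum_distrib_left mult_ac)
  finally show ?thesis .
qed

lemma matsunaga_mean_bounds:
  assumes "n \<ge> 2" "\<And>k. \<bar>pmf (matsunaga_pmf n) k - cycle_prob_int n k\<bar> \<le> d * cycle_prob_int n k"
  shows "\<bar>measure_pmf.expectation (matsunaga_pmf n) real_of_int - harm n\<bar> \<le> d * harm n"
  using expectation_matsunaga_pmf_approx[OF assms, of real_of_int]
  by (simp add: cycle_mean_eq[symmetric] cycle_mean_def)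

text \<open>Both laws are compared through their second moments about the Matsunaga mean
  \<open>e\<close>. For the cycle law this is the variance plus the squared distance of the means,
  and that distance is at most \<open>d * harm n\<close>.\<close>

lemma matsunaga_variance_bounds:
  assumes "n \<ge> 2" "\<And>k. \<bar>pmf (matsunaga_pmf n) k - cycle_prob_int n k\<bar> \<le> d * cycle_prob_int n k"
    and "0 \<le> d" "d \<le> 1"
  shows "measure_pmf.variance (matsunaga_pmf n) real_of_int \<ge> (1 - d) * cycle_var n"
    and "measure_pmf.variance (matsunaga_pmf n) real_of_int \<le> (1 + d) * (cycle_var n + (d * harm n)\<^sup>2)"
proof -
  define e where "e = measure_pmf.expectation (matsunaga_pmf n) real_of_int"
  define V where "V = measure_pmf.variance (matsunaga_pmf n) real_of_int"
  define W where "W = cycle_var n + (cycle_mean n - e)\<^sup>2"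
  have "\<bar>V - (\<Sum>k\<le>n. (real k - e)\<^sup>2 * cycle_prob n k)\<bar> \<le> d * (\<Sum>k\<le>n. (real k - e)\<^sup>2 * cycle_prob n k)"
    using expectation_matsunaga_pmf_approx[OF assms(1,2), of "\<lambda>k. (real_of_int k - e)\<^sup>2"]
    by (simp add: V_def e_def)
  hence V: "\<bar>V - W\<bar> \<le> d * W" unfolding cycle_second_moment W_def .
  have "(1 - d) * cycle_var n \<le> (1 - d) * W"
    using assms by (intro mult_left_mono) (auto simp: W_def)
  also have "\<dots> \<le> V" using V by (simp add: algebra_simps)
  finally show "V \<ge> (1 - d) * cycle_var n" .
  have "\<bar>e - harm n\<bar>\<^sup>2 \<le> (d * harm n)\<^sup>2"
    unfolding e_def by (intro power_mono matsunaga_mean_bounds assms) auto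
  hence "W \<le> cycle_var n + (d * harm n)\<^sup>2"
    by (simp add: W_def cycle_mean_eq power2_commute)
  hence "(1 + d) * W \<le> (1 + d) * (cycle_var n + (d * harm n)\<^sup>2)"
    using assms by (intro mult_left_mono) auto
  moreover have "V \<le> (1 + d) * W" using V by (simp add: algebra_simps)
  ultimately show "V \<le> (1 + d) * (cycle_var n + (d * harm n)\<^sup>2)" by linarith
qed

lemma asymp_equiv_sandwich_ratio:
  fixes f l u g :: "nat \<Rightarrow> real"
  assumes "\<forall>\<^sub>F n in at_top. l n \<le> f n" "\<forall>\<^sub>F n in at_top. f n \<le> u n" "\<forall>\<^sub>F n in at_top. g n > 0"
    and "(\<lambda>n. l n / g n) \<longlonglongrightarrow> 1" "(\<lambda>n. u n / g n) \<longlonglongrightarrow> 1"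
  shows "f \<sim>[at_top] g"
proof (rule asymp_equivI')
  show "(\<lambda>n. f n / g n) \<longlonglongrightarrow> 1"
  proof (rule tendsto_sandwich[OF _ _ assms(4,5)])
    show "\<forall>\<^sub>F n in at_top. l n / g n \<le> f n / g n"
      using assms(1,3) by eventually_elim (simp add: divide_right_mono)
    show "\<forall>\<^sub>F n in at_top. f n / g n \<le> u n / g n"
      using assms(2,3) by eventually_elim (simp add: divide_right_mono)
  qed
qed

text \<open>A real \<open>SUP\<close> is meaningful only for a set bounded above; the uniform bound
  supplies this as well as the estimate.\<close>

lemma SUP_abs_bigo:
  fixes f :: "nat \<Rightarrow> int \<Rightarrow> real"
  assumes "\<forall>\<^sub>F n in at_top. \<forall>k. \<bar>f n k\<bar> \<le> C * g n" "\<forall>\<^sub>F n in at_top. g n \<ge> 0"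
  shows "(\<lambda>n. SUP k. \<bar>f n k\<bar>) \<in> O[at_top](g)"
proof (rule bigoI[of _ C])
  show "\<forall>\<^sub>F n in at_top. norm (SUP k. \<bar>f n k\<bar>) \<le> C * norm (g n)"
    using assms
  proof eventually_elim
    case (elim n)
    have bdd: "bdd_above (range (\<lambda>k. \<bar>f n k\<bar>))"
      using elim by (auto intro!: bdd_aboveI[of _ "C * g n"])
    have "0 \<le> \<bar>f n 0\<bar>" by simp
    also have "\<dots> \<le> (SUP k. \<bar>f n k\<bar>)" by (rule cSUP_upper[OF _ bdd]) simp
    finally have "0 \<le> (SUP k. \<bar>f n k\<bar>)" .
    moreover have "(SUP k. \<bar>f n k\<bar>) \<le> C * g n"
      using elim by (intro cSUP_least) auto
    ultimately show ?case using elim by simp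
  qed
qed

theorem theorem2:
  "(\<lambda>n. measure_pmf.expectation (matsunaga_pmf n) real_of_int) \<sim>[at_top] (\<lambda>n. ln (real n)) \<and>
   (\<lambda>n. measure_pmf.variance (matsunaga_pmf n) real_of_int) \<sim>[at_top] (\<lambda>n. ln (real n)) \<and>
   (\<lambda>n. SUP k :: int. \<bar>sqrt (ln (real n)) * pmf (matsunaga_pmf n) k
         - 1 / sqrt (2 * pi) * exp (- ((real_of_int k - ln (real n))\<^sup>2 / (2 * ln (real n))))\<bar>)
      \<in> O[at_top](\<lambda>n. ln (real n) powr (- 1 / 2))"
proof (intro conjI)
  obtain C where C: "C > 0" and ev: "\<forall>\<^sub>F n in at_top. \<forall>k.
      \<bar>pmf (matsunaga_pmf n) k - cycle_prob_int n k\<bar> \<le> C / sqrt (real n) * cycle_prob_int n k"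
    using matsunaga_pmf_approx by blast
  have ev_C: "\<forall>\<^sub>F n :: nat in at_top. C / sqrt (real n) < 1"
    by real_asymp
  have ev_2: "\<forall>\<^sub>F n :: nat in at_top. n \<ge> 2"
    by (rule eventually_ge_at_top)
  have ev_ln: "\<forall>\<^sub>F n :: nat in at_top. ln (real n) > 0"
    by real_asymp

  show "(\<lambda>n. measure_pmf.expectation (matsunaga_pmf n) real_of_int) \<sim>[at_top] (\<lambda>n. ln (real n))"
  proof (rule asymp_equiv_sandwich_ratio[OF _ _ ev_ln])
    have *: "\<forall>\<^sub>F n in at_top. \<bar>measure_pmf.expectation (matsunaga_pmf n) real_of_int - harm n\<bar>
               \<le> C / sqrt (real n) * harm n"
      using ev ev_2 by eventually_elim (rule matsunaga_mean_bounds, auto)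
    show "\<forall>\<^sub>F n in at_top. (1 - C / sqrt (real n)) * ln (real n) \<le>
            measure_pmf.expectation (matsunaga_pmf n) real_of_int"
      using * ev_C ev_2
    proof eventually_elim
      case (elim n)
      have "(1 - C / sqrt (real n)) * ln (real n) \<le> (1 - C / sqrt (real n)) * harm n"
        using elim by (intro mult_left_mono harm_ge_ln') auto
      thus ?case using elim by (simp add: left_diff_distrib)
    qed
    show "\<forall>\<^sub>F n in at_top. measure_pmf.expectation (matsunaga_pmf n) real_of_int \<le>
            (1 + C / sqrt (real n)) * (ln (real n) + 1)"
      using * ev_2
    proof eventually_elim
      case (elim n)
      have "(1 + C / sqrt (real n)) * harm n \<le> (1 + C / sqrt (real n)) * (ln (real n) + 1)"
        using elim C by (intro mult_left_mono harm_le_ln) auto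
      thus ?case using elim by (simp add: distrib_right)
    qed
    show "(\<lambda>n. (1 - C / sqrt (real n)) * ln (real n) / ln (real n)) \<longlonglongrightarrow> 1"
         "(\<lambda>n. (1 + C / sqrt (real n)) * (ln (real n) + 1) / ln (real n)) \<longlonglongrightarrow> 1"
      by real_asymp+
  qed

  show "(\<lambda>n. measure_pmf.variance (matsunaga_pmf n) real_of_int) \<sim>[at_top] (\<lambda>n. ln (real n))"
  proof (rule asymp_equiv_sandwich_ratio[OF _ _ ev_ln])
    \<comment> \<open>The 2 bounds the sum of inverse squares by which the cycle variance falls
      short of \<open>harm n\<close>.\<close>
    show "\<forall>\<^sub>F n in at_top. (1 - C / sqrt (real n)) * (ln (real n) - 2) \<le>
            measure_pmf.variance (matsunaga_pmf n) real_of_int"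
      using ev ev_C ev_2
    proof eventually_elim
      case (elim n)
      have "ln (real n) - 2 \<le> cycle_var n"
        using harm_ge_ln'[of n] sum_inverse_squares_le[of n] elim by (simp add: cycle_var_eq)
      hence "(1 - C / sqrt (real n)) * (ln (real n) - 2) \<le> (1 - C / sqrt (real n)) * cycle_var n"
        using elim by (intro mult_left_mono) auto
      also have "\<dots> \<le> measure_pmf.variance (matsunaga_pmf n) real_of_int"
        by (rule matsunaga_variance_bounds) (use elim C in auto)
      finally show ?case .
    qed
    show "\<forall>\<^sub>F n in at_top. measure_pmf.variance (matsunaga_pmf n) real_of_int \<le>
            (1 + C / sqrt (real n)) * (ln (real n) + 1 + (C / sqrt (real n) * (ln (real n) + 1))\<^sup>2)"
      using ev ev_C ev_2
    proof eventually_elim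
      case (elim n)
      have harm: "harm n \<le> ln (real n) + 1" using elim by (intro harm_le_ln) auto
      have "(\<Sum>i<n. 1 / real (Suc i) ^ 2) \<ge> 0" by (intro sum_nonneg) auto
      hence var: "cycle_var n \<le> ln (real n) + 1"
        using harm unfolding cycle_var_eq by linarith
      have "measure_pmf.variance (matsunaga_pmf n) real_of_int \<le>
              (1 + C / sqrt (real n)) * (cycle_var n + (C / sqrt (real n) * harm n)\<^sup>2)"
        by (rule matsunaga_variance_bounds) (use elim C in auto)
      also have "\<dots> \<le> (1 + C / sqrt (real n)) * (ln (real n) + 1 + (C / sqrt (real n) * (ln (real n) + 1))\<^sup>2)"
        using C harm var by (intro mult_left_mono add_mono power_mono) (auto simp: harm_nonneg)
      finally show ?case .
    qed
    show "(\<lambda>n. (1 - C / sqrt (real n)) * (ln (real n) - 2) / ln (real n)) \<longlonglongrightarrow> 1"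
      by real_asymp
    show "(\<lambda>n. (1 + C / sqrt (real n)) * (ln (real n) + 1 + (C / sqrt (real n) * (ln (real n) + 1))\<^sup>2) / ln (real n)) \<longlonglongrightarrow> 1"
      using C by real_asymp
  qed

  obtain D where D: "D \<ge> 0" "\<And>n k. n \<ge> 2 \<Longrightarrow> \<bar>sqrt (ln (real n)) * cycle_prob_int n k
      - 1 / sqrt (2 * pi) * exp (- ((real_of_int k - ln (real n))\<^sup>2 / (2 * ln (real n))))\<bar>
        \<le> D / sqrt (ln (real n))"
    using cycle_prob_local_limit by blast
  show "(\<lambda>n. SUP k :: int. \<bar>sqrt (ln (real n)) * pmf (matsunaga_pmf n) k
         - 1 / sqrt (2 * pi) * exp (- ((real_of_int k - ln (real n))\<^sup>2 / (2 * ln (real n))))\<bar>)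
      \<in> O[at_top](\<lambda>n. ln (real n) powr (- 1 / 2))"
  proof (rule SUP_abs_bigo[of _ "D + 1"])
    \<comment> \<open>Exactly what turns the transfer error \<open>sqrt L * (C / sqrt n)\<close>
      into at most \<open>1 / sqrt L\<close>; this accounts for the 1 in
      \<open>D + 1\<close>.\<close>
    have "\<forall>\<^sub>F n :: nat in at_top. C * ln (real n) < sqrt (real n)"
      by real_asymp
    with ev ev_2 ev_ln
    show "\<forall>\<^sub>F n in at_top. \<forall>k. \<bar>sqrt (ln (real n)) * pmf (matsunaga_pmf n) k
         - 1 / sqrt (2 * pi) * exp (- ((real_of_int k - ln (real n))\<^sup>2 / (2 * ln (real n))))\<bar>
           \<le> (D + 1) * ln (real n) powr (- 1 / 2)"
    proof eventually_elim
      case (elim n)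
      show ?case
      proof
        fix k
        define L where "L = ln (real n)"
        define G where "G = 1 / sqrt (2 * pi) * exp (- ((real_of_int k - L)\<^sup>2 / (2 * L)))"
        define P where "P = pmf (matsunaga_pmf n) k"
        define p where "p = cycle_prob_int n k"
        have L: "L > 0" using elim by (simp add: L_def)
        have "\<bar>P - p\<bar> \<le> C / sqrt (real n) * p" using elim by (simp add: P_def p_def)
        also have "\<dots> \<le> C / sqrt (real n) * 1"
          using C cycle_prob_int_bounds[of n k] by (intro mult_left_mono) (auto simp: p_def)
        finally have "sqrt L * \<bar>P - p\<bar> \<le> sqrt L * (C / sqrt (real n))"
          using L by (intro mult_left_mono) auto
        also have "\<dots> \<le> 1 / sqrt L"
          using L elim by (simp add: field_simps L_def)
        finally have "\<bar>sqrt L * P - sqrt L * p\<bar> \<le> 1 / sqrt L"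
          using L by (simp add: abs_mult flip: right_diff_distrib)
        moreover have "\<bar>sqrt L * p - G\<bar> \<le> D / sqrt L"
          using D(2)[of n k] elim by (simp add: L_def p_def G_def)
        ultimately have "\<bar>sqrt L * P - G\<bar> \<le> (D + 1) / sqrt L"
          unfolding add_divide_distrib by linarith
        also have "(D + 1) / sqrt L = (D + 1) * L powr (- 1 / 2)"
          using L by (simp add: powr_minus_divide powr_half_sqrt)
        finally show "\<bar>sqrt (ln (real n)) * pmf (matsunaga_pmf n) k
           - 1 / sqrt (2 * pi) * exp (- ((real_of_int k - ln (real n))\<^sup>2 / (2 * ln (real n))))\<bar>
             \<le> (D + 1) * ln (real n) powr (- 1 / 2)"
          by (simp add: L_def P_def G_def)
      qed
    qed
  qed auto
qed

end
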